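(* Consider the online allocation problem and Algorithm 1 described in the context, with step-size $\eta\ge0$ and initial dual solution $\mu_1\in\mathbb{R}^m_+$. Suppose Assumption 1 and Assumption 2 hold and the requests $\gamma_1,\dots,\gamma_T$ are drawn independently, $\gamma_t\sim\mathcal P_t$, from (not necessarily identical) distributions $\vec{\mathcal P}=(\mathcal P_1,\dots,\mathcal P_T)\in\Delta(\mathcal S)^T$. For $\delta>0$ let $\mathcal C^{\mathrm{ID}}(\delta)=\{\vec{\mathcal P}\in\Delta(\mathcal S)^T:\mathrm{MD}(\vec{\mathcal P})\le\delta\}$, where $\mathrm{MD}(\vec{\mathcal P})=\sum_{t=1}^T\big\|\mathcal P_t-\frac1T\sum_{s=1}^T\mathcal P_s\big\|_{\mathrm{TV}}$. Then for every $T\ge1$ and $\delta>0$, $$\sup_{\vec{\mathcal P}\in\mathcal C^{\mathrm{ID}}(\delta)}\mathbb{E}_{\vec\gamma\sim\vec{\mathcal P}}\big[\mathrm{OPT}(\vec\gamma)-R(A\mid\vec\gamma)\big]\le C_1+C_2\eta T+\frac{C_3}{\eta}+C_4\delta,$$ with $C_1=\bar f\bar b/\underline\rho$, $C_2=(\bar b+\bar\rho)^2/(2\sigma)$, $C_3=\max\{V_h(\mu,\mu_1):\mu\in\{0,(\bar f/\rho_1)e_1,\ldots,(\bar f/\rho_m)e_m\}\}$ ($e_j$ the $j$-th unit vector) and $C_4=\bar f$.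
   Context: Online allocation problem: horizon $T\ge1$, $m\ge1$ resources. A request is $\gamma=(f,b,\mathcal X)$ with $\mathcal X\subset\mathbb{R}^d_+$ compact, $0\in\mathcal X$, $f:\mathcal X\to\mathbb{R}_+$, $b:\mathcal X\to\mathbb{R}^m_+$, $b(0)=0$; $\mathcal S$ is the set of possible requests, $\Delta(\mathcal S)$ the probability distributions on $\mathcal S$, $\|\cdot\|_{\mathrm{TV}}$ total variation distance. Resource vector $\rho$, all $\rho_j>0$, total resources $T\rho$; $\underline\rho=\min_j\rho_j$, $\bar\rho=\max_j\rho_j$. $\mathrm{OPT}(\vec\gamma)=\max\{\sum_t f_t(x_t):x_t\in\mathcal X_t,\sum_t b_t(x_t)\le T\rho\}$; $R(A\mid\vec\gamma)=\sum_t f_t(x_t)$ for the actions $x_t$ of algorithm $A$. Assumption 1: there exist $\bar f,\bar b\ge0$ such that for every $(f,b,\mathcal X)\in\mathcal S$: $0\in\mathcal X$; $0\le f\le\bar f$; $b\ge0$, $\|b(x)\|_\infty\le\bar b$; $\max_{x\in\mathcal X}\{f(x)-\mu^\top b(x)\}$ attained for all $\mu\in\mathbb{R}^m_+$. Assumption 2: $h$ differentiable (or essentially smooth) on $\mathbb{R}^m_+$ and $\sigma$-strongly convex w.r.t. $\|\cdot\|_1$ there. $V_h(x,y)=h(x)-h(y)-\nabla h(y)^\top(x-y)$. Algorithm 1: $B_1=T\rho$; for each $t$: $\tilde x_t\in\arg\max_{x\in\mathcal X_t}\{f_t(x)-\mu_t^\top b_t(x)\}$; $x_t=\tilde x_t$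 if $b_t(\tilde x_t)\le B_t$, else $0$; $B_{t+1}=B_t-b_t(x_t)$; $\tilde g_t=\rho-b_t(\tilde x_t)$; $\mu_{t+1}=\arg\min_{\mu\in\mathbb{R}^m_+}\{\tilde g_t^\top\mu+\frac1\eta V_h(\mu,\mu_t)\}$. *)

theory Defs
  imports "HOL-Probability.Probability"
begin

section \<open>Requests and the hindsight optimum\<close>

text \<open>
  Conventions. Rounds are numbered \<open>0, \<dots>, T - 1\<close>, and a request sequence is a function
  \<open>\<gamma>\<close> on \<open>nat\<close> of which only \<open>\<gamma> t\<close> with \<open>t < T\<close> matters. The order on \<open>real ^ 'n\<close> is
  componentwise. The reward and the consumption are total functions; their values outside the
  action set are never used.
\<close>

datatype ('d::finite, 'm::finite) request =
  Request (reward: "real ^ 'd \<Rightarrow> real")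
          (consumption: "real ^ 'd \<Rightarrow> real ^ 'm")
          (actions: "(real ^ 'd) set")

definition valid_request :: "('d::finite, 'm::finite) request \<Rightarrow> bool" where
  "valid_request \<gamma> \<longleftrightarrow>
     compact (actions \<gamma>) \<and> actions \<gamma> \<subseteq> {x. 0 \<le> x} \<and> 0 \<in> actions \<gamma> \<and>
     (\<forall>x \<in> actions \<gamma>. 0 \<le> reward \<gamma> x \<and> 0 \<le> consumption \<gamma> x) \<and>
     consumption \<gamma> 0 = 0"

abbreviation lagrangian :: "('d::finite, 'm::finite) request \<Rightarrow> real ^ 'm \<Rightarrow> real ^ 'd \<Rightarrow> real" where
  "lagrangian \<gamma> \<mu> x \<equiv> reward \<gamma> x - \<mu> \<bullet> consumption \<gamma> x"

definition assumption1 :: "('d::finite, 'm::finite) request set \<Rightarrow> real \<Rightarrow> real \<Rightarrow> bool" where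
  "assumption1 S fbar bbar \<longleftrightarrow> 0 \<le> fbar \<and> 0 \<le> bbar \<and>
     (\<forall>\<gamma> \<in> S. 0 \<in> actions \<gamma> \<and>
        (\<forall>x \<in> actions \<gamma>. 0 \<le> reward \<gamma> x \<and> reward \<gamma> x \<le> fbar \<and>
                       0 \<le> consumption \<gamma> x \<and> infnorm (consumption \<gamma> x) \<le> bbar) \<and>
        (\<forall>\<mu> \<ge> 0. \<exists>x. is_arg_max (lagrangian \<gamma> \<mu>) (\<lambda>x. x \<in> actions \<gamma>) x))"

text \<open>
  The supremum equals the maximum whenever the latter is attained; attainment is not assumed.
\<close>

definition OPT :: "nat \<Rightarrow> real ^ 'm \<Rightarrow> (nat \<Rightarrow> ('d::finite, 'm::finite) request) \<Rightarrow> real" where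
  "OPT T \<rho> \<gamma> =
     (SUP x \<in> {x. (\<forall>t<T. x t \<in> actions (\<gamma> t)) \<and>
                 (\<Sum>t<T. consumption (\<gamma> t) (x t)) \<le> real T *\<^sub>R \<rho>}.
        \<Sum>t<T. reward (\<gamma> t) (x t))"

section \<open>The reference function\<close>

abbreviation orthant :: "(real ^ 'm::finite) set" where
  "orthant \<equiv> {\<mu>. 0 \<le> \<mu>}"

definition norm_1 :: "real ^ 'm::finite \<Rightarrow> real" where
  "norm_1 x = (\<Sum>j\<in>UNIV. \<bar>x $ j\<bar>)"

definition strongly_convex_on ::
  "(real ^ 'm::finite \<Rightarrow> real) \<Rightarrow> (real ^ 'm) set \<Rightarrow> real \<Rightarrow> (real ^ 'm \<Rightarrow> real) \<Rightarrow> bool" where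
  "strongly_convex_on N A \<sigma> h \<longleftrightarrow>
     (\<forall>x \<in> A. \<forall>y \<in> A. \<forall>u \<in> {0..1}.
        h (u *\<^sub>R x + (1 - u) *\<^sub>R y)
          \<le> u * h x + (1 - u) * h y - \<sigma> / 2 * u * (1 - u) * (N (x - y))\<^sup>2)"

text \<open>
  Differentiability and the gradient are taken within the orthant, so that only the values of
  \<open>h\<close> there matter. The orthant has nonempty interior and is convex, so the gradient is
  unique at boundary points too; at interior points this is the ordinary gradient.
\<close>

definition grad :: "(real ^ 'm::finite \<Rightarrow> real) \<Rightarrow> real ^ 'm \<Rightarrow> real ^ 'm" where
  "grad h y = (THE g. (h has_derivative (\<lambda>v. g \<bullet> v)) (at y within orthant))"

definition essentially_smooth :: "(real ^ 'm::finite \<Rightarrow> real) \<Rightarrow> bool" where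
  "essentially_smooth h \<longleftrightarrow>
     h differentiable_on interior orthant \<and>
     (\<forall>y z. (\<forall>n. y n \<in> interior orthant) \<longrightarrow> z \<in> frontier orthant \<longrightarrow> y \<longlonglongrightarrow> z \<longrightarrow>
        filterlim (\<lambda>n. norm (grad h (y n))) at_top sequentially)"

definition assumption2 :: "(real ^ 'm::finite \<Rightarrow> real) \<Rightarrow> real \<Rightarrow> bool" where
  "assumption2 h \<sigma> \<longleftrightarrow>
     (h differentiable_on orthant \<or> essentially_smooth h) \<and>
     0 < \<sigma> \<and> strongly_convex_on norm_1 orthant \<sigma> h"

definition bregman :: "(real ^ 'm::finite \<Rightarrow> real) \<Rightarrow> real ^ 'm \<Rightarrow> real ^ 'm \<Rightarrow> real" where
  "bregman h x y = h x - h y - grad h y \<bullet> (x - y)"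

section \<open>Dual mirror descent\<close>

text \<open>
  The objective is extended-real valued so that it also makes sense for \<open>\<eta> = 0\<close>: then
  \<open>V / \<eta>\<close> is \<open>\<infinity>\<close> for \<open>V > 0\<close> and \<open>0\<close> for \<open>V = 0\<close>, and the
  minimizer is the current iterate.
\<close>

definition mirror_step ::
  "(real ^ 'm::finite \<Rightarrow> real) \<Rightarrow> real \<Rightarrow> real ^ 'm \<Rightarrow> real ^ 'm \<Rightarrow> real ^ 'm" where
  "mirror_step h \<eta> g \<nu> =
     arg_min_on (\<lambda>\<mu>. ereal (g \<bullet> \<mu>) + ereal (bregman h \<mu> \<nu>) / ereal \<eta>) orthant"

text \<open>
  The algorithm may break ties in the arg max arbitrarily, as long as it does not look into the
  future. This choice is made by a selection rule, which sees the past requests, the current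
  request and the current dual variable.
\<close>

type_synonym ('d, 'm) selection =
  "('d, 'm) request list \<Rightarrow> ('d, 'm) request \<Rightarrow> real ^ 'm \<Rightarrow> real ^ 'd"

definition valid_selection ::
  "('d::finite, 'm::finite) request set \<Rightarrow> ('d, 'm) selection \<Rightarrow> bool" where
  "valid_selection S sel \<longleftrightarrow>
     (\<forall>past \<in> lists S. \<forall>\<gamma> \<in> S. \<forall>\<mu> \<ge> 0.
        is_arg_max (lagrangian \<gamma> \<mu>) (\<lambda>x. x \<in> actions \<gamma>) (sel past \<gamma> \<mu>))"

context
  fixes sel :: "('d::finite, 'm::finite) selection"
    and h :: "real ^ 'm \<Rightarrow> real"
    and \<eta> :: real
    and \<mu>\<^sub>1 :: "real ^ 'm"
    and \<rho> :: "real ^ 'm"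
begin

primrec dual :: "(nat \<Rightarrow> ('d, 'm) request) \<Rightarrow> nat \<Rightarrow> real ^ 'm" where
  "dual \<gamma> 0 = \<mu>\<^sub>1"
| "dual \<gamma> (Suc t) =
     mirror_step h \<eta>
       (\<rho> - consumption (\<gamma> t) (sel (map \<gamma> [0..<t]) (\<gamma> t) (dual \<gamma> t)))
       (dual \<gamma> t)"

definition tentative :: "(nat \<Rightarrow> ('d, 'm) request) \<Rightarrow> nat \<Rightarrow> real ^ 'd" where
  "tentative \<gamma> t = sel (map \<gamma> [0..<t]) (\<gamma> t) (dual \<gamma> t)"

definition action_within :: "real ^ 'm \<Rightarrow> (nat \<Rightarrow> ('d, 'm) request) \<Rightarrow> nat \<Rightarrow> real ^ 'd" where
  "action_within B \<gamma> t =
     (if consumption (\<gamma> t) (tentative \<gamma> t) \<le> B then tentative \<gamma> t else 0)"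

primrec budget :: "nat \<Rightarrow> (nat \<Rightarrow> ('d, 'm) request) \<Rightarrow> nat \<Rightarrow> real ^ 'm" where
  "budget T \<gamma> 0 = real T *\<^sub>R \<rho>"
| "budget T \<gamma> (Suc t) =
     budget T \<gamma> t - consumption (\<gamma> t) (action_within (budget T \<gamma> t) \<gamma> t)"

definition total_reward :: "nat \<Rightarrow> (nat \<Rightarrow> ('d, 'm) request) \<Rightarrow> real" where
  "total_reward T \<gamma> = (\<Sum>t<T. reward (\<gamma> t) (action_within (budget T \<gamma> t) \<gamma> t))"

end

section \<open>Independent requests with bounded mean deviation\<close>

definition tv_dist :: "'a measure \<Rightarrow> 'a measure \<Rightarrow> real" where
  "tv_dist P Q = (SUP A \<in> sets P. \<bar>measure P A - measure Q A\<bar>)"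

text \<open>Drawing \<open>t\<close> uniformly and then sampling from \<open>P t\<close> gives the average \<open>1/T \<Sum>\<^sub>t P t\<close>.\<close>

definition mean_distribution :: "nat \<Rightarrow> (nat \<Rightarrow> 'a measure) \<Rightarrow> 'a measure" where
  "mean_distribution T P = uniform_count_measure {..<T} \<bind> P"

definition mean_deviation :: "nat \<Rightarrow> (nat \<Rightarrow> 'a measure) \<Rightarrow> real" where
  "mean_deviation T P = (\<Sum>t<T. tv_dist (P t) (mean_distribution T P))"

definition C_ID :: "'a measure \<Rightarrow> nat \<Rightarrow> real \<Rightarrow> (nat \<Rightarrow> 'a measure) set" where
  "C_ID S T \<delta> =
     {P \<in> {..<T} \<rightarrow>\<^sub>E space (prob_algebra S). mean_deviation T P \<le> \<delta>}"

end

theory Submission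
  imports Defs
begin

text \<open>
  Round \<open>t\<close> is called affordable if, for every resource, the tentative consumption before \<open>t\<close>
  leaves at least \<open>bbar\<close> of the budget. This depends on the past only, and as long as it holds the
  algorithm takes its tentative actions. Along each path, the regret of mirror descent over the
  affordable rounds is taken against \<open>0\<close> if all rounds are affordable, and otherwise against
  \<open>(fbar / \<rho>\<^sub>j) e\<^sub>j\<close> for a nearly exhausted resource \<open>j\<close>: this comparator pays \<open>fbar\<close> for each of
  the remaining rounds, up to \<open>C1\<close>. Hence the reward is, up to the error terms, at least the sum over
  all rounds of the dual value \<open>f\<^sub>t\<^sup>*(\<mu>\<^sub>t) + \<mu>\<^sub>t \<bullet> \<rho>\<close> (or \<open>fbar\<close>, if \<open>t\<close> is not affordable). Given the
  past, the expectation of this value changes by at most \<open>fbar\<close> times the total variation distance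
  when \<open>P t\<close> is replaced by the mean distribution, and then it is at least \<open>1/T\<close> of the expected
  optimum by weak duality.

  At \<open>\<eta> = 0\<close> either \<open>fbar = 0\<close> and the left-hand side vanishes, or \<open>C3 > 0\<close> and the bound is infinite.
\<close>

section \<open>Mirror descent on the orthant\<close>

lemma closed_orthant: "closed (orthant :: (real ^ 'm::finite) set)"
proof -
  have "orthant = {x :: real ^ 'm. \<forall>j. 0 \<le> x $ j}"
    by (simp add: less_eq_vec_def)
  then show ?thesis
    by (simp add: closed_Collect_all closed_Collect_le continuous_on_component)
qed

lemma convex_orthant: "convex (orthant :: (real ^ 'm::finite) set)"
  by (auto simp: convex_def less_eq_vec_def)

lemma interior_orthant_nonempty: "interior (orthant :: (real ^ 'm::finite) set) \<noteq> {}"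
proof -
  have "open (\<Inter>j. {x :: real ^ 'm. 0 < x $ j})"
    by (intro open_INT ballI open_Collect_less continuous_intros) auto
  then have "{x :: real ^ 'm. \<forall>j. 0 < x $ j} \<subseteq> interior orthant"
    by (intro interior_maximal) (auto simp: less_eq_vec_def less_imp_le Collect_all_eq)
  moreover have "(\<chi> j. 1) \<in> {x :: real ^ 'm. \<forall>j. 0 < x $ j}"
    by simp
  ultimately show ?thesis by blast
qed

text \<open>A translate of the interior by a nonnegative vector is an open subset of the orthant,
  hence part of the interior. Together with \<open>smooth_interior\<close>, this keeps forward
  difference quotients inside the domain of the gradient.\<close>

lemma interior_orthant_add:
  assumes "x \<in> interior orthant" "v \<in> orthant"
  shows "x + v \<in> interior (orthant :: (real ^ 'm::finite) set)"
proof -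
  have "(+) v ` interior orthant \<subseteq> interior orthant"
  proof (rule interior_maximal)
    show "(+) v ` interior orthant \<subseteq> orthant"
      using interior_subset[of orthant] assms(2) by (auto simp: add_nonneg_nonneg subset_iff)
    show "open ((+) v ` interior orthant)"
      by (intro open_translation open_interior)
  qed
  then show ?thesis
    using assms(1) by (auto simp: add.commute)
qed

lemma segment_interior_orthant:
  assumes "z \<in> orthant" "p \<in> interior orthant" "0 < s" "s \<le> 1"
  shows "z + s *\<^sub>R (p - z) \<in> interior (orthant :: (real ^ 'm::finite) set)"
  using mem_interior_convex_shrink[OF convex_orthant assms(2,1,3,4)]
  by (simp add: algebra_simps)

lemma segment_orthant:
  assumes "z \<in> orthant" "x \<in> orthant" "0 \<le> s" "s \<le> 1"
  shows "z + s *\<^sub>R (x - z) \<in> (orthant :: (real ^ 'm::finite) set)"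
  using convexD_alt[OF convex_orthant assms(1,2,3,4)] by (simp add: algebra_simps)

lemma norm_le_norm_1: "norm x \<le> norm_1 x"
  unfolding norm_1_def by (rule norm_le_l1_cart)

lemma norm_1_minus_commute: "norm_1 (x - y) = norm_1 (y - x)"
  unfolding norm_1_def by (simp add: abs_minus_commute)

lemma inner_le_norm_1:
  fixes g x :: "real ^ 'm::finite"
  assumes "\<And>j. \<bar>g $ j\<bar> \<le> G"
  shows "g \<bullet> x \<le> G * norm_1 x"
proof -
  have "g \<bullet> x \<le> (\<Sum>j\<in>UNIV. \<bar>g $ j\<bar> * \<bar>x $ j\<bar>)"
    unfolding inner_vec_def by (intro sum_mono) (simp flip: abs_mult)
  also have "\<dots> \<le> (\<Sum>j\<in>UNIV. G * \<bar>x $ j\<bar>)"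
    by (intro sum_mono mult_right_mono assms) simp
  finally show ?thesis
    by (simp add: norm_1_def sum_distrib_left)
qed

text \<open>The chain rule along the segment from \<open>y\<close> to \<open>y + v\<close>. Only
  this segment is known to lie in \<open>A\<close>, so the limit is one-sided; this is what makes
  the statement usable at frontier points of the orthant.\<close>

lemma directional_derivative:
  assumes "(f has_derivative f') (at y within A)"
    and "\<And>s. 0 \<le> s \<Longrightarrow> s \<le> 1 \<Longrightarrow> y + s *\<^sub>R v \<in> A"
  shows "((\<lambda>s::real. (f (y + s *\<^sub>R v) - f y) / s) \<longlongrightarrow> f' v) (at_right 0)"
proof -
  let ?l = "\<lambda>s::real. y + s *\<^sub>R v"
  have "((\<lambda>s. f (?l s)) has_derivative (\<lambda>s. f' (s *\<^sub>R v))) (at 0 within {0..1})"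
  proof (rule has_derivative_in_compose[where f = ?l and g = f])
    show "(?l has_derivative (\<lambda>s. s *\<^sub>R v)) (at 0 within {0..1})"
      by (auto intro!: derivative_eq_intros)
    show "(f has_derivative f') (at (?l 0) within ?l ` {0..1})"
      using assms by (auto intro: has_derivative_subset)
  qed
  then have "((\<lambda>s. f (?l s)) has_real_derivative f' v) (at 0 within {0..1})"
    unfolding has_field_derivative_def
    by (rule has_derivative_eq_rhs)
      (auto simp: linear_scale[OF has_derivative_linear[OF assms(1)]] mult.commute)
  then show ?thesis
    by (simp add: has_field_derivative_iff at_within_Icc_at_right)
qed

section \<open>The gradient of the reference function and the Bregman divergence\<close>

locale mirror_map =
  fixes h :: "real ^ 'm::finite \<Rightarrow> real" and \<sigma> :: real
  assumes assumption2: "assumption2 h \<sigma>"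
begin

lemma sigma_pos: "0 < \<sigma>"
  using assumption2 by (simp add: assumption2_def)

lemma strongly_convex:
  assumes "x \<in> orthant" "y \<in> orthant" "0 \<le> u" "u \<le> 1"
  shows "h (y + u *\<^sub>R (x - y))
    \<le> h y + u * (h x - h y) - \<sigma> / 2 * u * (1 - u) * (norm_1 (x - y))\<^sup>2"
proof -
  have "h (u *\<^sub>R x + (1 - u) *\<^sub>R y)
      \<le> u * h x + (1 - u) * h y - \<sigma> / 2 * u * (1 - u) * (norm_1 (x - y))\<^sup>2"
    using assumption2 assms by (auto simp: assumption2_def strongly_convex_on_def)
  then show ?thesis
    by (simp add: algebra_simps)
qed

text \<open>The points at which \<open>grad h\<close> is meaningful. By \<open>smooth_cases\<close>
  and \<open>smooth_interior\<close> this is either the whole orthant or, in the essentially smooth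
  case, exactly its interior, so that both alternatives of \<open>assumption2\<close> can be treated
  alike. All dual iterates stay in this set.\<close>

definition smooth :: "(real ^ 'm) set" where
  "smooth = {y \<in> orthant. h differentiable (at y within orthant)}"

lemma smooth_orthant: "y \<in> smooth \<Longrightarrow> y \<in> orthant"
  by (simp add: smooth_def)

lemma smooth_nonneg: "y \<in> smooth \<Longrightarrow> 0 \<le> y"
  by (simp add: smooth_def)

lemma smooth_cases:
  obtains "smooth = orthant"
  | "essentially_smooth h" "interior orthant \<subseteq> smooth"
proof (cases "h differentiable_on orthant")
  case True
  then have "smooth = orthant"
    by (auto simp: smooth_def differentiable_on_def)
  then show thesis by (rule that(1))
next
  case False
  then have es: "essentially_smooth h"
    using assumption2 by (simp add: assumption2_def)
  have "interior orthant \<subseteq> smooth"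
  proof
    fix y :: "real ^ 'm" assume y: "y \<in> interior orthant"
    then have "h differentiable (at y within interior orthant)"
      using es unfolding essentially_smooth_def differentiable_on_def by blast
    then have "h differentiable (at y)"
      by (simp add: at_within_open[OF y open_interior])
    then show "y \<in> smooth"
      using y interior_subset[of orthant] differentiable_at_withinI
      unfolding smooth_def by blast
  qed
  with es show thesis by (rule that(2))
qed

lemma interior_smooth: "interior orthant \<subseteq> smooth"
  by (cases rule: smooth_cases) (use interior_subset in auto)

text \<open>Steps in the positive coordinate directions never leave the orthant, so forward
  difference quotients determine every component of the gradient even on the frontier. This yields
  uniqueness of the gradient and, later, its measurability.\<close>

lemma has_derivative_component_tendsto:
  assumes "(h has_derivative (\<lambda>v. g \<bullet> v)) (at y within orthant)" "y \<in> orthant"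
  shows "(\<lambda>n. (h (y + (1 / real (Suc n)) *\<^sub>R axis j 1) - h y) * real (Suc n)) \<longlonglongrightarrow> g $ j"
proof -
  have "((\<lambda>s. (h (y + s *\<^sub>R axis j 1) - h y) / s) \<longlongrightarrow> g \<bullet> axis j 1) (at_right 0)"
    using assms(2)
    by (intro directional_derivative[OF assms(1)])
       (auto simp: less_eq_vec_def axis_def)
  moreover have "filterlim (\<lambda>n. 1 / real (Suc n)) (at_right 0) sequentially"
    unfolding inverse_eq_divide[symmetric]
    by (rule filterlim_compose[OF filterlim_inverse_at_right_top
          filterlim_compose[OF filterlim_real_sequentially filterlim_Suc]])
  ultimately have "(\<lambda>n. (h (y + (1 / real (Suc n)) *\<^sub>R axis j 1) - h y) / (1 / real (Suc n)))
      \<longlonglongrightarrow> g \<bullet> axis j 1"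
    by (rule filterlim_compose)
  then show ?thesis
    by (simp add: inner_axis del: of_nat_Suc)
qed

lemma has_derivative_grad:
  assumes "y \<in> smooth"
  shows "(h has_derivative (\<lambda>v. grad h y \<bullet> v)) (at y within orthant)"
proof -
  obtain h' where h': "(h has_derivative h') (at y within orthant)"
    using assms by (auto simp: smooth_def differentiable_def)
  then have "linear h'"
    by (rule has_derivative_linear)
  \<comment> \<open>The vector \<open>adjoint h' 1\<close> represents the linear functional
    \<open>h'\<close>.\<close>
  then have "h' = (\<lambda>v. adjoint h' 1 \<bullet> v)"
    using adjoint_clauses(2)[of h' 1] by (simp add: fun_eq_iff)
  then have g: "(h has_derivative (\<lambda>v. adjoint h' 1 \<bullet> v)) (at y within orthant)"
    using h' by simp
  have "\<exists>!g. (h has_derivative (\<lambda>v. g \<bullet> v)) (at y within orthant)"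
  proof (rule ex1I[of _ "adjoint h' 1"])
    fix g' assume g': "(h has_derivative (\<lambda>v. g' \<bullet> v)) (at y within orthant)"
    have "g' $ j = adjoint h' 1 $ j" for j
      using has_derivative_component_tendsto[OF g' smooth_orthant[OF assms]]
        has_derivative_component_tendsto[OF g smooth_orthant[OF assms]]
      by (rule LIMSEQ_unique)
    then show "g' = adjoint h' 1"
      by (simp add: vec_eq_iff)
  qed (rule g)
  then show ?thesis
    unfolding grad_def by (rule theI')
qed

lemma continuous_on_smooth: "continuous_on smooth h"
proof -
  have "continuous (at y within smooth) h" if "y \<in> smooth" for y
    using has_derivative_continuous[OF has_derivative_grad[OF that]]
    by (rule continuous_within_subset) (auto simp: smooth_def)
  then show ?thesis
    by (simp add: continuous_on_eq_continuous_within)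
qed

lemma grad_tendsto:
  assumes "y \<in> smooth" "x \<in> orthant"
  shows "((\<lambda>s. (h (y + s *\<^sub>R (x - y)) - h y) / s) \<longlongrightarrow> grad h y \<bullet> (x - y)) (at_right 0)"
  by (intro directional_derivative[OF has_derivative_grad] segment_orthant assms smooth_orthant)

text \<open>Dividing the strong convexity inequality on the segment from \<open>y\<close> to
  \<open>x\<close> by the parameter \<open>s\<close> and letting \<open>s\<close> tend to 0 turns
  the difference quotient into the gradient term, while the factor \<open>1 - s\<close> of the
  quadratic term tends to 1.\<close>

lemma bregman_ge:
  assumes "y \<in> smooth" "x \<in> orthant"
  shows "\<sigma> / 2 * (norm_1 (x - y))\<^sup>2 \<le> bregman h x y"
proof -
  have "grad h y \<bullet> (x - y) \<le> h x - h y - \<sigma> / 2 * (1 - 0) * (norm_1 (x - y))\<^sup>2"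
  proof (rule tendsto_le[OF _ _ grad_tendsto[OF assms]])
    show "((\<lambda>s. h x - h y - \<sigma> / 2 * (1 - s) * (norm_1 (x - y))\<^sup>2)
        \<longlongrightarrow> h x - h y - \<sigma> / 2 * (1 - 0) * (norm_1 (x - y))\<^sup>2) (at_right 0)"
      by (intro tendsto_intros)
    show "\<forall>\<^sub>F s in at_right 0. (h (y + s *\<^sub>R (x - y)) - h y) / s
        \<le> h x - h y - \<sigma> / 2 * (1 - s) * (norm_1 (x - y))\<^sup>2"
    proof (rule eventually_mono[OF eventually_at_right_real[of 0 1]])
      fix s :: real assume "s \<in> {0<..<1}"
      then have s: "0 < s" "s < 1" by auto
      then have "h (y + s *\<^sub>R (x - y)) - h y
          \<le> (h x - h y - \<sigma> / 2 * (1 - s) * (norm_1 (x - y))\<^sup>2) * s"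
        using strongly_convex[OF assms(2) smooth_orthant[OF assms(1)], of s]
        by (simp add: algebra_simps)
      then show "(h (y + s *\<^sub>R (x - y)) - h y) / s
          \<le> h x - h y - \<sigma> / 2 * (1 - s) * (norm_1 (x - y))\<^sup>2"
        using s by (simp add: pos_divide_le_eq)
    qed simp
  qed simp
  then show ?thesis
    by (simp add: bregman_def)
qed

lemma bregman_nonneg: "y \<in> smooth \<Longrightarrow> x \<in> orthant \<Longrightarrow> 0 \<le> bregman h x y"
  using bregman_ge[of y x] sigma_pos zero_le_power2[of "norm_1 (x - y)"]
  by (smt (verit) mult_nonneg_nonneg half_gt_zero)

lemma bregman_pos:
  assumes "y \<in> smooth" "x \<in> orthant" "x \<noteq> y"
  shows "0 < bregman h x y"
proof -
  have "0 < norm_1 (x - y)"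
    using norm_le_norm_1[of "x - y"] assms(3) by (smt (verit) zero_less_norm_iff eq_iff_diff_eq_0)
  then have "0 < \<sigma> / 2 * (norm_1 (x - y))\<^sup>2"
    using sigma_pos by simp
  then show ?thesis
    using bregman_ge[OF assms(1,2)] by simp
qed

lemma grad_monotone:
  assumes "y \<in> smooth" "x \<in> orthant"
  shows "h y + grad h y \<bullet> (x - y) \<le> h x"
  using bregman_nonneg[OF assms] by (simp add: bregman_def)

section \<open>Existence of minimizers of linearly tilted reference functions\<close>

lemma minimizing_sequence:
  assumes "A \<noteq> {}" "A \<subseteq> orthant"
  obtains y z c where "\<And>n. y n \<in> A" "y \<longlonglongrightarrow> z"
    "(\<lambda>n. h (y n) - \<theta> \<bullet> y n) \<longlonglongrightarrow> c" "\<And>x. x \<in> A \<Longrightarrow> c \<le> h x - \<theta> \<bullet> x"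
proof -
  define F where "F x = h x - \<theta> \<bullet> x" for x
  obtain p where p: "p \<in> smooth"
    using interior_smooth interior_orthant_nonempty by blast
  define a where "a = norm (grad h p - \<theta>)"
  \<comment> \<open>By strong convexity at the single point \<open>p\<close>, the tilted objective
    grows at least quadratically in the distance from \<open>p\<close>. This bounds it from below
    and confines any minimizing sequence to a ball; the limit \<open>z\<close> may leave
    \<open>A\<close>, and no continuity at \<open>z\<close> is claimed.\<close>
  have quad: "F p - a * norm (x - p) + \<sigma> / 2 * (norm (x - p))\<^sup>2 \<le> F x" if "x \<in> orthant" for x
  proof -
    have "F p + (grad h p - \<theta>) \<bullet> (x - p) + \<sigma> / 2 * (norm_1 (x - p))\<^sup>2 \<le> F x"
      using bregman_ge[OF p that] by (simp add: F_def bregman_def inner_diff_left inner_diff_right)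
    moreover have "- (a * norm (x - p)) \<le> (grad h p - \<theta>) \<bullet> (x - p)"
      using Cauchy_Schwarz_ineq2[of "grad h p - \<theta>" "x - p"] by (simp add: a_def abs_le_iff)
    moreover have "\<sigma> / 2 * (norm (x - p))\<^sup>2 \<le> \<sigma> / 2 * (norm_1 (x - p))\<^sup>2"
      using sigma_pos by (intro mult_left_mono power_mono norm_le_norm_1) auto
    ultimately show ?thesis by simp
  qed
  \<comment> \<open>The constant is the vertex value of the quadratic in \<open>quad\<close>,
    reached at distance \<open>a / \<sigma>\<close> from \<open>p\<close>.\<close>
  have below: "F p - a\<^sup>2 / (2 * \<sigma>) \<le> F x" if "x \<in> A" for x
  proof -
    have "0 \<le> (a - \<sigma> * norm (x - p))\<^sup>2 / (2 * \<sigma>)"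
      using sigma_pos by simp
    also have "\<dots> = a\<^sup>2 / (2 * \<sigma>) - a * norm (x - p) + \<sigma> / 2 * (norm (x - p))\<^sup>2"
      using sigma_pos by (simp add: power2_eq_square field_simps)
    finally show ?thesis
      using quad[of x] that assms(2) by auto
  qed
  define c where "c = Inf (F ` A)"
  have bdd: "bdd_below (F ` A)"
    using below by (rule bdd_belowI2)
  have c_le: "c \<le> F x" if "x \<in> A" for x
    unfolding c_def using bdd that by (intro cInf_lower) auto
  have "\<exists>x\<in>A. F x < c + 1 / real (Suc n)" for n
    using cInf_lessD[of "F ` A" "c + 1 / real (Suc n)"] assms(1) by (auto simp: c_def)
  then obtain y where y: "\<And>n. y n \<in> A" "\<And>n. F (y n) < c + 1 / real (Suc n)"
    by metis
  have Fy: "(\<lambda>n. F (y n)) \<longlonglongrightarrow> c"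
  proof (rule tendsto_sandwich[OF _ _ tendsto_const])
    show "(\<lambda>n. c + 1 / real (Suc n)) \<longlonglongrightarrow> c"
      using tendsto_add[OF tendsto_const LIMSEQ_inverse_real_of_nat, of c]
      by (simp add: inverse_eq_divide)
  qed (use y c_le in \<open>auto intro!: always_eventually less_imp_le\<close>)
  define C where "C = c + 1 - F p"
  \<comment> \<open>Beyond this radius the quadratic in \<open>quad\<close> exceeds
    \<open>F p + C = c + 1\<close>, whereas the values along the sequence stay below that. The
    summand 1 makes the distance at least 1, so that \<open>\<bar>C\<bar>\<close> can be absorbed
    into a multiple of it.\<close>
  have "norm (y n - p) \<le> 1 + 2 * (a + \<bar>C\<bar>) / \<sigma>" for n
  proof (rule ccontr)
    assume "\<not> ?thesis"
    then have r: "1 + 2 * (a + \<bar>C\<bar>) / \<sigma> < norm (y n - p)" (is "_ < ?r") by simp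
    have "0 \<le> 2 * (a + \<bar>C\<bar>) / \<sigma>"
      using sigma_pos by (simp add: a_def)
    then have "1 < ?r" using r by simp
    have "2 * (a + \<bar>C\<bar>) / \<sigma> < ?r" using r by simp
    then have "a + \<bar>C\<bar> < \<sigma> / 2 * ?r"
      using sigma_pos by (simp add: field_simps)
    then have "(a + \<bar>C\<bar>) * ?r < \<sigma> / 2 * ?r * ?r"
      using \<open>1 < ?r\<close> by (intro mult_strict_right_mono) auto
    moreover have "\<bar>C\<bar> \<le> \<bar>C\<bar> * ?r"
      using \<open>1 < ?r\<close> mult_left_mono[of 1 ?r "\<bar>C\<bar>"] by simp
    ultimately have "C < \<sigma> / 2 * ?r\<^sup>2 - a * ?r"
      by (simp add: algebra_simps power2_eq_square)
    then have "c + 1 < F (y n)"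
      using quad[of "y n"] y(1)[of n] assms(2) by (auto simp: C_def)
    moreover have "1 / real (Suc n) \<le> 1" by simp
    ultimately show False
      using y(2)[of n] by linarith
  qed
  then have "bounded (range (\<lambda>n. y n - p))"
    by (auto simp: bounded_iff)
  from bounded_translation[OF this, of p] have "bounded (range y)"
    by (simp add: image_image)
  then obtain z r where zr: "strict_mono r" "(y \<circ> r) \<longlonglongrightarrow> z"
    using bounded_imp_convergent_subsequence by blast
  have "(F \<circ> y \<circ> r) \<longlonglongrightarrow> c"
    using LIMSEQ_subseq_LIMSEQ[OF Fy zr(1)] by (simp add: comp_def)
  with zr that[of "y \<circ> r" z c] y(1) c_le show thesis
    by (auto simp: F_def comp_def)
qed

text \<open>
  Moving from a frontier limit \<open>z\<close> of a minimizing sequence towards an interior point \<open>p\<close>, the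
  objective has nonnegative slope, while the values on a ball around \<open>p\<close> bound the gradient
  in all directions from above. So the gradients stay bounded along this segment.
\<close>

lemma minimizing_sequence_interior:
  assumes es: "essentially_smooth h"
    and y: "\<And>n. y n \<in> interior orthant" "y \<longlonglongrightarrow> z"
    and c: "(\<lambda>n. h (y n) - \<theta> \<bullet> y n) \<longlonglongrightarrow> c" "\<And>x. x \<in> interior orthant \<Longrightarrow> c \<le> h x - \<theta> \<bullet> x"
  shows "z \<in> interior orthant"
proof (rule ccontr)
  assume "z \<notin> interior orthant"
  moreover have z: "z \<in> orthant"
    using closed_sequentially[OF closed_orthant _ y(2)] y(1) interior_subset by blast
  ultimately have fr: "z \<in> frontier orthant"
    using closure_subset[of orthant] by (auto simp: frontier_def)
  define F where "F x = h x - \<theta> \<bullet> x" for x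
  define G where "G x = grad h x - \<theta>" for x
  have F_ge: "F x + G x \<bullet> (q - x) \<le> F q" if "x \<in> interior orthant" "q \<in> orthant" for x q
    using grad_monotone[of x q] that interior_smooth
    by (auto simp: F_def G_def inner_diff_left inner_diff_right)
  obtain p :: "real ^ 'm" where p: "p \<in> interior orthant"
    using interior_orthant_nonempty by blast
  then obtain r where r: "r > 0" "cball p r \<subseteq> interior orthant"
    using open_contains_cball[of "interior orthant"] by auto
  have "continuous_on (cball p r) F"
    unfolding F_def using r(2) interior_smooth
    by (intro continuous_intros continuous_on_subset[OF continuous_on_smooth]) auto
  then have "bdd_above (F ` cball p r)"
    by (intro bounded_imp_bdd_above compact_imp_bounded compact_continuous_image compact_cball)
  then obtain M where M: "F q \<le> M" if "q \<in> cball p r" for q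
    by (auto simp: bdd_above_def simp del: mem_cball)
  define w where "w n = z + (1 / real (Suc n)) *\<^sub>R (p - z)" for n
  have w_int: "w n \<in> interior orthant" for n
    unfolding w_def by (rule segment_interior_orthant[OF z p]) auto
  have "r * norm (G (w n)) \<le> M - c" for n
  proof -
    let ?s = "1 / real (Suc n)" and ?g = "G (w n)"
    \<comment> \<open>Since \<open>h\<close> need not be continuous at \<open>z\<close>, the limit
      is taken only in the affine minorant at \<open>w n\<close>: its value at \<open>z\<close> is
      at most \<open>c\<close>, hence at most \<open>F (w n)\<close>, which gives the sign of the
      slope.\<close>
    have "(\<lambda>k. F (w n) + ?g \<bullet> (y k - w n)) \<longlonglongrightarrow> F (w n) + ?g \<bullet> (z - w n)"
      by (intro tendsto_intros y)
    moreover have "F (w n) + ?g \<bullet> (y k - w n) \<le> F (y k)" for k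
      using F_ge[OF w_int] y(1) interior_subset by blast
    ultimately have "F (w n) + ?g \<bullet> (z - w n) \<le> c"
      using c(1) unfolding F_def[symmetric] by (auto intro: LIMSEQ_le)
    moreover have "c \<le> F (w n)"
      using c(2)[OF w_int] by (simp add: F_def)
    moreover have "z - w n = - (?s *\<^sub>R (p - z))"
      by (simp add: w_def)
    ultimately have "0 \<le> ?s * (?g \<bullet> (p - z))"
      by simp
    then have slope: "0 \<le> ?g \<bullet> (p - z)"
      by (simp add: zero_le_divide_iff)
    \<comment> \<open>The point of the ball around \<open>p\<close> that lies farthest in the
      direction of the gradient; the inner product with the gradient then produces \<open>r\<close>
      times its norm.\<close>
    define q where "q = p + r *\<^sub>R sgn ?g"
    have q: "q \<in> cball p r"
      using r(1) by (auto simp: q_def dist_norm norm_sgn)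
    have "?g \<bullet> (q - w n) = r * norm ?g + (1 - ?s) * (?g \<bullet> (p - z))"
    proof -
      have "?g \<bullet> sgn ?g = norm ?g"
        by (cases "?g = 0")
          (simp_all add: sgn_div_norm inner_scaleR_right dot_square_norm power2_eq_square)
      moreover have "q - w n = r *\<^sub>R sgn ?g + (1 - ?s) *\<^sub>R (p - z)"
        unfolding q_def w_def by (simp add: scaleR_diff_left)
      ultimately show ?thesis
        by (simp only: inner_add_right inner_scaleR_right)
    qed
    moreover have "0 \<le> (1 - ?s) * (?g \<bullet> (p - z))"
      using slope by (intro mult_nonneg_nonneg) auto
    ultimately have "r * norm ?g \<le> ?g \<bullet> (q - w n)" by simp
    also have "\<dots> \<le> F q - F (w n)"
      using F_ge[OF w_int, of q n] q r(2) interior_subset by force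
    also have "\<dots> \<le> M - c"
      using M[OF q] \<open>c \<le> F (w n)\<close> by simp
    finally show ?thesis .
  qed
  then have "norm (G (w n)) \<le> (M - c) / r" for n
    using r(1) by (simp add: pos_le_divide_eq mult.commute)
  then have bound: "norm (grad h (w n)) \<le> (M - c) / r + norm \<theta>" for n
    using norm_triangle_sub[of "grad h (w n)" \<theta>] unfolding G_def by (smt (verit))
  have "w \<longlonglongrightarrow> z + 0 *\<^sub>R (p - z)"
    unfolding w_def by (intro tendsto_intros LIMSEQ_Suc[OF lim_1_over_n])
  then have "filterlim (\<lambda>n. norm (grad h (w n))) at_top sequentially"
    using es fr w_int unfolding essentially_smooth_def by simp
  then have "\<forall>\<^sub>F n in sequentially. (M - c) / r + norm \<theta> < norm (grad h (w n))"
    by (simp add: filterlim_at_top_dense)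
  then show False
    using bound by (auto simp: eventually_sequentially not_less[symmetric])
qed

text \<open>If \<open>h\<close> is differentiable on the whole orthant, it is continuous there, and
  the limit of a minimizing sequence is a minimizer. Otherwise one minimizes over the interior only:
  the limit is interior by \<open>minimizing_sequence_interior\<close>, and a frontier point cannot
  do better, because convexity on the segment from it to \<open>z\<close> bounds the interior values
  by a quantity that tends to the frontier value.\<close>

lemma minimizer_exists:
  obtains x where "x \<in> smooth" "\<And>\<mu>. \<mu> \<in> orthant \<Longrightarrow> h x - \<theta> \<bullet> x \<le> h \<mu> - \<theta> \<bullet> \<mu>"
proof (cases rule: smooth_cases)
  case 1
  obtain y z c where y: "\<And>n. y n \<in> orthant" "y \<longlonglongrightarrow> z"
    "(\<lambda>n. h (y n) - \<theta> \<bullet> y n) \<longlonglongrightarrow> c" "\<And>x. x \<in> orthant \<Longrightarrow> c \<le> h x - \<theta> \<bullet> x"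
    by (rule minimizing_sequence[of orthant \<theta>]) (use interior_orthant_nonempty in auto)
  have z: "z \<in> smooth"
    using closed_sequentially[OF closed_orthant y(1,2)] 1 by simp
  have "(\<lambda>n. h (y n) - \<theta> \<bullet> y n) \<longlonglongrightarrow> h z - \<theta> \<bullet> z"
    by (intro tendsto_intros y(2) continuous_on_tendsto_compose[OF continuous_on_smooth y(2) z])
      (use y(1) 1 in \<open>auto intro!: always_eventually\<close>)
  then have "c = h z - \<theta> \<bullet> z"
    using y(3) LIMSEQ_unique by blast
  with that z y(4) show thesis by blast
next
  case 2
  obtain y z c where y: "\<And>n. y n \<in> interior orthant" "y \<longlonglongrightarrow> z"
    "(\<lambda>n. h (y n) - \<theta> \<bullet> y n) \<longlonglongrightarrow> c" "\<And>x. x \<in> interior orthant \<Longrightarrow> c \<le> h x - \<theta> \<bullet> x"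
    by (rule minimizing_sequence[OF interior_orthant_nonempty interior_subset, of \<theta>]) blast
  have zi: "z \<in> interior orthant"
    using minimizing_sequence_interior[OF 2(1) y] .
  then have z: "z \<in> smooth" using 2(2) by blast
  have "(\<lambda>n. h (y n) - \<theta> \<bullet> y n) \<longlonglongrightarrow> h z - \<theta> \<bullet> z"
    by (intro tendsto_intros y(2) continuous_on_tendsto_compose[OF continuous_on_smooth y(2) z])
      (use y(1) 2 in \<open>auto intro!: always_eventually\<close>)
  then have c: "c = h z - \<theta> \<bullet> z"
    using y(3) LIMSEQ_unique by blast
  have "c \<le> h \<mu> - \<theta> \<bullet> \<mu>" if \<mu>: "\<mu> \<in> orthant" for \<mu>
  proof -
    define F where "F x = h x - \<theta> \<bullet> x" for x
    have *: "c \<le> F \<mu> + s * (F z - F \<mu>)" if s: "0 < s" "s < 1" for s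
    proof -
      have "\<mu> + s *\<^sub>R (z - \<mu>) \<in> interior orthant"
        using segment_interior_orthant[OF \<mu> zi] s by simp
      then have "c \<le> h (\<mu> + s *\<^sub>R (z - \<mu>)) - \<theta> \<bullet> (\<mu> + s *\<^sub>R (z - \<mu>))"
        by (rule y(4))
      moreover have "F \<mu> + s * (F z - F \<mu>) =
          h \<mu> + s * (h z - h \<mu>) - \<theta> \<bullet> (\<mu> + s *\<^sub>R (z - \<mu>))"
        by (simp add: F_def inner_add_right inner_diff_right algebra_simps)
      moreover have "h (\<mu> + s *\<^sub>R (z - \<mu>)) \<le> h \<mu> + s * (h z - h \<mu>) - \<sigma> / 2 * s * (1 - s) * (norm_1 (z - \<mu>))\<^sup>2"
        using strongly_convex[OF smooth_orthant[OF z] \<mu>, of s] s by simp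
      moreover have "0 \<le> \<sigma> / 2 * s * (1 - s) * (norm_1 (z - \<mu>))\<^sup>2"
        using sigma_pos s by simp
      ultimately show ?thesis
        by linarith
    qed
    have "c \<le> F \<mu> + 0 * (F z - F \<mu>)"
    proof (rule tendsto_lowerbound)
      show "((\<lambda>s. F \<mu> + s * (F z - F \<mu>)) \<longlongrightarrow> F \<mu> + 0 * (F z - F \<mu>)) (at_right 0)"
        by (intro tendsto_intros)
      show "\<forall>\<^sub>F s in at_right 0. c \<le> F \<mu> + s * (F z - F \<mu>)"
        by (rule eventually_mono[OF eventually_at_right_real[of 0 1]]) (use * in auto)
    qed simp
    then show ?thesis by (simp add: F_def)
  qed
  with that z c show thesis by blast
qed

text \<open>Tilting by its own gradient makes \<open>y\<close> a minimizer, so any interior sequence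
  tending to \<open>y\<close> is minimizing, and \<open>minimizing_sequence_interior\<close>
  excludes that \<open>y\<close> lies on the frontier.\<close>

lemma smooth_interior:
  assumes "essentially_smooth h" "y \<in> smooth"
  shows "y \<in> interior orthant"
proof -
  let ?\<theta> = "grad h y"
  obtain p :: "real ^ 'm" where p: "p \<in> interior orthant"
    using interior_orthant_nonempty by blast
  define w where "w n = y + (1 / real (Suc n)) *\<^sub>R (p - y)" for n
  have w_int: "w n \<in> interior orthant" for n
    unfolding w_def by (rule segment_interior_orthant[OF smooth_orthant[OF assms(2)] p]) auto
  have "w \<longlonglongrightarrow> y + 0 *\<^sub>R (p - y)"
    unfolding w_def by (intro tendsto_intros LIMSEQ_Suc[OF lim_1_over_n])
  then have w: "w \<longlonglongrightarrow> y" by simp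
  have "(\<lambda>n. h (w n) - ?\<theta> \<bullet> w n) \<longlonglongrightarrow> h y - ?\<theta> \<bullet> y"
    by (intro tendsto_intros w continuous_on_tendsto_compose[OF continuous_on_smooth w assms(2)])
      (use w_int interior_smooth in \<open>auto intro!: always_eventually\<close>)
  moreover have "h y - ?\<theta> \<bullet> y \<le> h x - ?\<theta> \<bullet> x" if "x \<in> interior orthant" for x
    using grad_monotone[OF assms(2), of x] that interior_subset
    by (force simp: inner_diff_right)
  ultimately show ?thesis
    using minimizing_sequence_interior[OF assms(1) w_int w] by blast
qed

section \<open>Measurability of the gradient\<close>

lemma smooth_add:
  assumes "y \<in> smooth" "v \<in> orthant"
  shows "y + v \<in> smooth"
proof (cases rule: smooth_cases)
  case 1
  then show ?thesis using assms by (simp add: add_nonneg_nonneg)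
next
  case 2
  then show ?thesis
    using interior_orthant_add[OF smooth_interior] assms by blast
qed

text \<open>Each component is a pointwise limit of forward difference quotients of \<open>h\<close>,
  which is continuous on \<open>smooth\<close>; the shifted points remain in \<open>smooth\<close>
  by \<open>smooth_add\<close>.\<close>

lemma borel_measurable_grad:
  assumes X: "X \<in> borel_measurable M" and smooth: "\<And>\<omega>. \<omega> \<in> space M \<Longrightarrow> X \<omega> \<in> smooth"
  shows "(\<lambda>\<omega>. grad h (X \<omega>)) \<in> borel_measurable M"
proof -
  have h_comp: "(\<lambda>\<omega>. h (Y \<omega>)) \<in> borel_measurable M"
    if "Y \<in> borel_measurable M" "\<And>\<omega>. \<omega> \<in> space M \<Longrightarrow> Y \<omega> \<in> smooth" for Y
    using that
    by (intro measurable_compose[OF measurable_restrict_space2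
          borel_measurable_continuous_on_restrict[OF continuous_on_smooth]]) auto
  have component: "(\<lambda>\<omega>. grad h (X \<omega>) $ j) \<in> borel_measurable M" for j
  proof (rule borel_measurable_LIMSEQ_metric)
    fix n
    have "X \<omega> + (1 / real (Suc n)) *\<^sub>R axis j 1 \<in> smooth" if "\<omega> \<in> space M" for \<omega>
      using smooth[OF that] by (rule smooth_add) (auto simp: less_eq_vec_def axis_def)
    then show "(\<lambda>\<omega>. (h (X \<omega> + (1 / real (Suc n)) *\<^sub>R axis j 1) - h (X \<omega>)) * real (Suc n))
        \<in> borel_measurable M"
      using X smooth by (intro borel_measurable_times borel_measurable_diff h_comp) auto
  next
    fix \<omega> assume "\<omega> \<in> space M"
    then show "(\<lambda>n. (h (X \<omega> + (1 / real (Suc n)) *\<^sub>R axis j 1) - h (X \<omega>)) * real (Suc n))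
        \<longlonglongrightarrow> grad h (X \<omega>) $ j"
      using smooth by (intro has_derivative_component_tendsto has_derivative_grad smooth_orthant)
  qed
  then show ?thesis
    by (subst borel_measurable_euclidean_space)
      (auto simp: Basis_vec_def inner_axis)
qed

section \<open>The proximal map (the gradient of the convex conjugate of \<open>h\<close> on the
  orthant) and the mirror step\<close>

definition prox :: "real ^ 'm \<Rightarrow> real ^ 'm" where
  "prox \<theta> = (SOME x. x \<in> smooth \<and> (\<forall>\<mu>\<in>orthant. h x - \<theta> \<bullet> x \<le> h \<mu> - \<theta> \<bullet> \<mu>))"

lemma prox:
  shows prox_smooth: "prox \<theta> \<in> smooth"
    and prox_le: "\<mu> \<in> orthant \<Longrightarrow> h (prox \<theta>) - \<theta> \<bullet> prox \<theta> \<le> h \<mu> - \<theta> \<bullet> \<mu>"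
proof -
  have "\<exists>x. x \<in> smooth \<and> (\<forall>\<mu>\<in>orthant. h x - \<theta> \<bullet> x \<le> h \<mu> - \<theta> \<bullet> \<mu>)"
    using minimizer_exists by metis
  from someI_ex[OF this] show "prox \<theta> \<in> smooth"
    and "\<mu> \<in> orthant \<Longrightarrow> h (prox \<theta>) - \<theta> \<bullet> prox \<theta> \<le> h \<mu> - \<theta> \<bullet> \<mu>"
    unfolding prox_def by blast+
qed

text \<open>The first-order condition: from a minimizer, the one-sided derivative of the tilted
  objective towards any point of the orthant is nonnegative.\<close>

lemma prox_optimality:
  assumes "\<mu> \<in> orthant"
  shows "\<theta> \<bullet> (\<mu> - prox \<theta>) \<le> grad h (prox \<theta>) \<bullet> (\<mu> - prox \<theta>)"
proof (rule tendsto_lowerbound[OF grad_tendsto[OF prox_smooth assms]])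
  show "\<forall>\<^sub>F s in at_right 0. \<theta> \<bullet> (\<mu> - prox \<theta>)
      \<le> (h (prox \<theta> + s *\<^sub>R (\<mu> - prox \<theta>)) - h (prox \<theta>)) / s"
  proof (rule eventually_mono[OF eventually_at_right_real[of 0 1]])
    fix s :: real assume "s \<in> {0<..<1}"
    then have s: "0 < s" "s < 1" by auto
    have "h (prox \<theta>) - \<theta> \<bullet> prox \<theta>
        \<le> h (prox \<theta> + s *\<^sub>R (\<mu> - prox \<theta>)) - \<theta> \<bullet> (prox \<theta> + s *\<^sub>R (\<mu> - prox \<theta>))"
      using s by (intro prox_le segment_orthant assms smooth_orthant prox_smooth) auto
    then have "\<theta> \<bullet> (\<mu> - prox \<theta>) * s \<le> h (prox \<theta> + s *\<^sub>R (\<mu> - prox \<theta>)) - h (prox \<theta>)"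
      by (simp add: inner_add_right algebra_simps)
    then show "\<theta> \<bullet> (\<mu> - prox \<theta>) \<le> (h (prox \<theta> + s *\<^sub>R (\<mu> - prox \<theta>)) - h (prox \<theta>)) / s"
      using s by (simp add: pos_le_divide_eq)
  qed simp
qed simp

lemma prox_strict:
  assumes "\<mu> \<in> orthant" "\<mu> \<noteq> prox \<theta>"
  shows "h (prox \<theta>) - \<theta> \<bullet> prox \<theta> < h \<mu> - \<theta> \<bullet> \<mu>"
  using bregman_pos[OF prox_smooth assms] prox_optimality[OF assms(1), of \<theta>]
  by (simp add: bregman_def inner_diff_right)

text \<open>Strong convexity around each of the two minimizers gives one inequality; in their sum
  the values of \<open>h\<close> cancel, and Cauchy-Schwarz finishes. The result serves twice: for
  measurability of \<open>prox\<close> and for bounding the dual iterates.\<close>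

lemma prox_Lipschitz: "\<sigma> * norm (prox \<theta> - prox \<theta>') \<le> norm (\<theta> - \<theta>')"
proof -
  let ?x = "prox \<theta>" and ?y = "prox \<theta>'"
  have half: "\<sigma> / 2 * (norm (x - y))\<^sup>2 \<le> h x - h y - \<xi> \<bullet> (x - y)"
    if "y = prox \<xi>" "x \<in> orthant" for x y \<xi>
  proof -
    have "\<sigma> / 2 * (norm (x - y))\<^sup>2 \<le> \<sigma> / 2 * (norm_1 (x - y))\<^sup>2"
      using sigma_pos by (intro mult_left_mono power_mono norm_le_norm_1) auto
    then show ?thesis
      using bregman_ge[OF prox_smooth that(2), of \<xi>] prox_optimality[OF that(2), of \<xi>]
      unfolding bregman_def that(1) by linarith
  qed
  have "\<sigma> * (norm (?x - ?y))\<^sup>2 \<le> (\<theta> - \<theta>') \<bullet> (?x - ?y)"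
    using half[of ?x \<theta> ?y, OF refl smooth_orthant[OF prox_smooth]]
      half[of ?y \<theta>' ?x, OF refl smooth_orthant[OF prox_smooth]]
    by (simp add: norm_minus_commute inner_diff_left inner_diff_right)
  also have "\<dots> \<le> norm (\<theta> - \<theta>') * norm (?x - ?y)"
    by (rule norm_cauchy_schwarz)
  finally show ?thesis
    by (cases "?x = ?y") (simp_all add: power2_eq_square)
qed

lemma borel_measurable_prox: "prox \<in> borel_measurable borel"
proof -
  have "(1 / \<sigma>)-lipschitz_on UNIV prox"
    using sigma_pos prox_Lipschitz
    by (intro lipschitz_onI) (auto simp: dist_norm field_simps)
  then show ?thesis
    by (intro borel_measurable_continuous_onI lipschitz_on_continuous_on)
qed

text \<open>Expanding the divergence shows that the objective is \<open>h\<close> tilted by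
  \<open>\<theta>\<close>, up to a positive factor and an additive constant. As
  \<open>arg_min_on\<close> chooses some minimizer, its value is identified through uniqueness
  (\<open>prox_strict\<close>).\<close>

lemma mirror_step_eq_prox:
  assumes "0 < \<eta>" "\<nu> \<in> smooth"
  shows "mirror_step h \<eta> g \<nu> = prox (grad h \<nu> - \<eta> *\<^sub>R g)"
proof -
  define \<theta> where "\<theta> = grad h \<nu> - \<eta> *\<^sub>R g"
  define c where "c = (grad h \<nu> \<bullet> \<nu> - h \<nu>) / \<eta>"
  define F where "F \<mu> = ereal (g \<bullet> \<mu>) + ereal (bregman h \<mu> \<nu>) / ereal \<eta>" for \<mu>
  have F: "F \<mu> = ereal ((h \<mu> - \<theta> \<bullet> \<mu>) / \<eta> + c)" for \<mu>
    using assms(1)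
    by (simp add: F_def \<theta>_def c_def bregman_def inner_diff_left inner_diff_right field_simps)
  have "is_arg_min F (\<lambda>\<mu>. \<mu> \<in> orthant) = (\<lambda>x. x = prox \<theta>)"
  proof (intro ext iffI)
    fix x assume "is_arg_min F (\<lambda>\<mu>. \<mu> \<in> orthant) x"
    then have "x \<in> orthant" "\<not> F (prox \<theta>) < F x"
      using prox_smooth smooth_nonneg unfolding is_arg_min_def by auto
    then show "x = prox \<theta>"
      using prox_strict[of x \<theta>] assms(1) by (force simp: F divide_strict_right_mono)
  next
    fix x assume "x = prox \<theta>"
    then show "is_arg_min F (\<lambda>\<mu>. \<mu> \<in> orthant) x"
      using prox_le[of _ \<theta>] prox_smooth smooth_nonneg assms(1)
      by (auto simp: is_arg_min_def F not_less divide_right_mono)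
  qed
  then show ?thesis
    unfolding mirror_step_def arg_min_on_def arg_min_def F_def[symmetric] \<theta>_def[symmetric]
    by simp
qed

text \<open>The divergence is positive away from \<open>\<nu>\<close>, so division by zero makes the
  objective infinite everywhere else. This lets the iterates stay in \<open>smooth\<close> for step
  size zero as well.\<close>

lemma mirror_step_zero:
  assumes "\<nu> \<in> smooth"
  shows "mirror_step h 0 g \<nu> = \<nu>"
proof -
  define F where "F \<mu> = ereal (g \<bullet> \<mu>) + ereal (bregman h \<mu> \<nu>) / ereal 0" for \<mu>
  have F: "F \<mu> = (if \<mu> = \<nu> then ereal (g \<bullet> \<nu>) else \<infinity>)" if "\<mu> \<in> orthant" for \<mu>
  proof (cases "\<mu> = \<nu>")
    case True
    then show ?thesis
      by (simp add: F_def bregman_def zero_ereal_def[symmetric])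
  next
    case False
    then show ?thesis
      using bregman_pos[OF assms that] by (simp add: F_def divide_ereal_def)
  qed
  have "is_arg_min F (\<lambda>\<mu>. \<mu> \<in> orthant) = (\<lambda>x. x = \<nu>)"
    using smooth_orthant[OF assms] by (auto simp: is_arg_min_def F fun_eq_iff split: if_splits)
  then show ?thesis
    unfolding mirror_step_def arg_min_on_def arg_min_def F_def[symmetric] by simp
qed

lemma mirror_step_smooth:
  assumes "0 \<le> \<eta>" "\<nu> \<in> smooth"
  shows "mirror_step h \<eta> g \<nu> \<in> smooth"
  using assms by (cases "\<eta> = 0") (auto simp: mirror_step_zero mirror_step_eq_prox prox_smooth)

text \<open>The optimality condition together with the three-point identity for divergences bounds
  the regret of the new point \<open>x\<close> by the telescoping difference minus the divergence
  from \<open>\<nu>\<close> to \<open>x\<close>. The remaining term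
  \<open>g \<bullet> (\<nu> - x)\<close> is paid for by that divergence.\<close>

lemma mirror_step_regret:
  assumes \<eta>: "0 < \<eta>" and \<nu>: "\<nu> \<in> smooth" and \<mu>: "\<mu> \<in> orthant" and G: "\<And>j. \<bar>g $ j\<bar> \<le> G"
  shows "g \<bullet> (\<nu> - \<mu>) \<le>
    (bregman h \<mu> \<nu> - bregman h \<mu> (mirror_step h \<eta> g \<nu>)) / \<eta> + G\<^sup>2 / (2 * \<sigma>) * \<eta>"
proof -
  define x where "x = mirror_step h \<eta> g \<nu>"
  have x: "x = prox (grad h \<nu> - \<eta> *\<^sub>R g)"
    using mirror_step_eq_prox[OF \<eta> \<nu>] by (simp add: x_def)
  have "\<eta> * (g \<bullet> (x - \<mu>)) \<le> bregman h \<mu> \<nu> - bregman h \<mu> x - bregman h x \<nu>"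
    using prox_optimality[OF \<mu>, of "grad h \<nu> - \<eta> *\<^sub>R g"] unfolding x[symmetric]
    by (simp add: bregman_def inner_diff_left inner_diff_right algebra_simps)
  moreover have "\<eta> * (g \<bullet> (\<nu> - x)) \<le> bregman h x \<nu> + G\<^sup>2 / (2 * \<sigma>) * \<eta>\<^sup>2"
  proof -
    let ?N = "norm_1 (x - \<nu>)"
    have "\<eta> * (g \<bullet> (\<nu> - x)) \<le> \<eta> * (G * ?N)"
      using inner_le_norm_1[OF G, of "\<nu> - x"] \<eta> by (simp add: norm_1_minus_commute)
    \<comment> \<open>Expanding this square is Young's inequality, balanced so that the quadratic
      term matches strong convexity.\<close>
    moreover have "0 \<le> (\<sigma> * ?N - \<eta> * G)\<^sup>2 / (2 * \<sigma>)"
      using sigma_pos by simp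
    moreover have "(\<sigma> * ?N - \<eta> * G)\<^sup>2 / (2 * \<sigma>)
        = \<sigma> / 2 * ?N\<^sup>2 + G\<^sup>2 / (2 * \<sigma>) * \<eta>\<^sup>2 - \<eta> * (G * ?N)"
      using sigma_pos by (simp add: power2_eq_square field_simps)
    moreover have "\<sigma> / 2 * ?N\<^sup>2 \<le> bregman h x \<nu>"
      using bregman_ge[OF \<nu>, of x] prox_smooth smooth_orthant unfolding x by blast
    ultimately show ?thesis by linarith
  qed
  ultimately have "\<eta> * (g \<bullet> (\<nu> - \<mu>)) \<le> bregman h \<mu> \<nu> - bregman h \<mu> x + G\<^sup>2 / (2 * \<sigma>) * \<eta>\<^sup>2"
    by (simp add: inner_diff_right algebra_simps)
  then have "g \<bullet> (\<nu> - \<mu>) \<le> (bregman h \<mu> \<nu> - bregman h \<mu> x + G\<^sup>2 / (2 * \<sigma>) * \<eta>\<^sup>2) / \<eta>"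
    using \<eta> by (simp add: pos_le_divide_eq mult.commute)
  also have "\<dots> = (bregman h \<mu> \<nu> - bregman h \<mu> x) / \<eta> + G\<^sup>2 / (2 * \<sigma>) * \<eta>"
    using \<eta> by (simp add: add_divide_distrib power2_eq_square)
  finally show ?thesis
    unfolding x_def .
qed

end

section \<open>The algorithm along a fixed request sequence\<close>

locale allocation = mirror_map h \<sigma>
  for h :: "real ^ 'm::finite \<Rightarrow> real" and \<sigma> :: real +
  fixes S :: "('d::finite, 'm) request measure"
    and sel :: "('d, 'm) selection"
    and \<eta> fbar bbar :: real
    and \<mu>\<^sub>1 \<rho> :: "real ^ 'm"
    and T :: nat
  assumes resources: "\<And>j. 0 < \<rho> $ j"
    and valid: "\<And>\<gamma>. \<gamma> \<in> space S \<Longrightarrow> valid_request \<gamma>"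
    and assumption1: "assumption1 (space S) fbar bbar"
    and step_size: "0 \<le> \<eta>"
    and initial_dual: "\<mu>\<^sub>1 \<in> smooth"
    and selection: "valid_selection (space S) sel"
begin

abbreviation dual_at :: "(nat \<Rightarrow> ('d, 'm) request) \<Rightarrow> nat \<Rightarrow> real ^ 'm" where
  "dual_at \<equiv> dual sel h \<eta> \<mu>\<^sub>1 \<rho>"

abbreviation tentative_at :: "(nat \<Rightarrow> ('d, 'm) request) \<Rightarrow> nat \<Rightarrow> real ^ 'd" where
  "tentative_at \<equiv> tentative sel h \<eta> \<mu>\<^sub>1 \<rho>"

abbreviation budget_at :: "(nat \<Rightarrow> ('d, 'm) request) \<Rightarrow> nat \<Rightarrow> real ^ 'm" where
  "budget_at \<equiv> budget sel h \<eta> \<mu>\<^sub>1 \<rho> T"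

abbreviation action_at :: "(nat \<Rightarrow> ('d, 'm) request) \<Rightarrow> nat \<Rightarrow> real ^ 'd" where
  "action_at \<gamma> t \<equiv> action_within sel h \<eta> \<mu>\<^sub>1 \<rho> (budget_at \<gamma> t) \<gamma> t"

abbreviation earned :: "(nat \<Rightarrow> ('d, 'm) request) \<Rightarrow> nat \<Rightarrow> real" where
  "earned \<gamma> t \<equiv> reward (\<gamma> t) (tentative_at \<gamma> t)"

abbreviation consumed :: "(nat \<Rightarrow> ('d, 'm) request) \<Rightarrow> nat \<Rightarrow> real ^ 'm" where
  "consumed \<gamma> t \<equiv> consumption (\<gamma> t) (tentative_at \<gamma> t)"

text \<open>For admissible arguments this is the maximum of the Lagrangian over the actions, so the
  past affects only tie-breaking and not the value. Writing it through \<open>sel\<close> allows its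
  measurability to be read off from that of the algorithm.\<close>

definition conjugate :: "('d, 'm) request list \<Rightarrow> real ^ 'm \<Rightarrow> ('d, 'm) request \<Rightarrow> real" where
  "conjugate past \<mu> \<gamma> = lagrangian \<gamma> \<mu> (sel past \<gamma> \<mu>)"

definition paths :: "(nat \<Rightarrow> ('d, 'm) request) set" where
  "paths = {\<gamma>. \<forall>t<T. \<gamma> t \<in> space S}"

definition C1 :: real where "C1 = fbar * bbar / Min (range (\<lambda>j. \<rho> $ j))"

definition C2 :: real where "C2 = (bbar + Max (range (\<lambda>j. \<rho> $ j)))\<^sup>2 / (2 * \<sigma>)"

definition C3 :: real where
  "C3 = Max ((\<lambda>\<mu>. bregman h \<mu> \<mu>\<^sub>1) ` insert 0 (range (\<lambda>j. (fbar / \<rho> $ j) *\<^sub>R axis j 1)))"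

lemma fbar_nonneg: "0 \<le> fbar" and bbar_nonneg: "0 \<le> bbar"
  using assumption1 by (auto simp: assumption1_def)

lemma request_bounds:
  assumes "\<gamma> \<in> space S" "x \<in> actions \<gamma>"
  shows reward_nonneg: "0 \<le> reward \<gamma> x" and reward_le: "reward \<gamma> x \<le> fbar"
    and consumption_nonneg: "0 \<le> consumption \<gamma> x"
    and consumption_le: "consumption \<gamma> x $ j \<le> bbar"
proof -
  have *: "0 \<le> reward \<gamma> x \<and> reward \<gamma> x \<le> fbar \<and> 0 \<le> consumption \<gamma> x \<and>
      infnorm (consumption \<gamma> x) \<le> bbar"
    using assumption1 assms unfolding assumption1_def by blast
  then show "0 \<le> reward \<gamma> x" "reward \<gamma> x \<le> fbar" "0 \<le> consumption \<gamma> x" by auto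
  show "consumption \<gamma> x $ j \<le> bbar"
    using component_le_infnorm_cart[of "consumption \<gamma> x" j] * by linarith
qed

lemma zero_action:
  assumes "\<gamma> \<in> space S"
  shows "0 \<in> actions \<gamma>" "consumption \<gamma> 0 = 0"
  using valid[OF assms] by (auto simp: valid_request_def)

lemma inner_nonneg: "0 \<le> x \<Longrightarrow> 0 \<le> y \<Longrightarrow> 0 \<le> x \<bullet> (y :: real ^ 'm)"
  by (auto simp: inner_vec_def less_eq_vec_def intro!: sum_nonneg)

lemma selected_arg_max:
  assumes "past \<in> lists (space S)" "\<gamma> \<in> space S" "0 \<le> \<mu>"
  shows "is_arg_max (lagrangian \<gamma> \<mu>) (\<lambda>x. x \<in> actions \<gamma>) (sel past \<gamma> \<mu>)"
  using selection assms unfolding valid_selection_def by blast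

lemma conjugate_ge:
  assumes "past \<in> lists (space S)" "\<gamma> \<in> space S" "0 \<le> \<mu>" "x \<in> actions \<gamma>"
  shows "lagrangian \<gamma> \<mu> x \<le> conjugate past \<mu> \<gamma>"
  using selected_arg_max[OF assms(1-3)] assms(4)
  by (auto simp: conjugate_def is_arg_max_def not_less)

lemma conjugate_bounds:
  assumes "past \<in> lists (space S)" "\<gamma> \<in> space S" "0 \<le> \<mu>"
  shows conjugate_nonneg: "0 \<le> conjugate past \<mu> \<gamma>"
    and conjugate_le: "conjugate past \<mu> \<gamma> \<le> fbar"
proof -
  show "0 \<le> conjugate past \<mu> \<gamma>"
    using conjugate_ge[OF assms zero_action(1)[OF assms(2)]]
      reward_nonneg[OF assms(2) zero_action(1)[OF assms(2)]] zero_action(2)[OF assms(2)]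
    by simp
  have "sel past \<gamma> \<mu> \<in> actions \<gamma>"
    using selected_arg_max[OF assms] by (simp add: is_arg_max_def)
  then show "conjugate past \<mu> \<gamma> \<le> fbar"
    using reward_le[OF assms(2)] inner_nonneg[OF assms(3) consumption_nonneg[OF assms(2)]]
    unfolding conjugate_def by (smt (verit))
qed

lemma dual_smooth: "dual_at \<gamma> t \<in> smooth"
  by (induction t) (simp_all add: initial_dual mirror_step_smooth step_size)

lemma dual_nonneg: "0 \<le> dual_at \<gamma> t"
  by (rule smooth_nonneg[OF dual_smooth])

lemma past_mem: "\<gamma> \<in> paths \<Longrightarrow> t \<le> T \<Longrightarrow> map \<gamma> [0..<t] \<in> lists (space S)"
  by (auto simp: paths_def in_lists_conv_set)

lemma path_mem: "\<gamma> \<in> paths \<Longrightarrow> t < T \<Longrightarrow> \<gamma> t \<in> space S"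
  by (simp add: paths_def)

lemma tentative_mem:
  assumes "\<gamma> \<in> paths" "t < T"
  shows "tentative_at \<gamma> t \<in> actions (\<gamma> t)"
  using selected_arg_max[OF past_mem path_mem dual_nonneg] assms
  by (simp add: tentative_def is_arg_max_def)

lemma earned_eq_conjugate:
  "earned \<gamma> t = conjugate (map \<gamma> [0..<t]) (dual_at \<gamma> t) (\<gamma> t) + dual_at \<gamma> t \<bullet> consumed \<gamma> t"
  by (simp add: conjugate_def tentative_def)

lemma action_mem: "\<gamma> \<in> paths \<Longrightarrow> t < T \<Longrightarrow> action_at \<gamma> t \<in> actions (\<gamma> t)"
  by (simp add: action_within_def tentative_mem zero_action path_mem)

lemma total_reward_nonneg: "\<gamma> \<in> paths \<Longrightarrow> 0 \<le> total_reward sel h \<eta> \<mu>\<^sub>1 \<rho> T \<gamma>"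
  by (auto simp: total_reward_def intro!: sum_nonneg reward_nonneg path_mem action_mem)

lemma total_reward_le: "\<gamma> \<in> paths \<Longrightarrow> total_reward sel h \<eta> \<mu>\<^sub>1 \<rho> T \<gamma> \<le> real T * fbar"
  using sum_mono[of "{..<T}" "\<lambda>t. reward (\<gamma> t) (action_at \<gamma> t)" "\<lambda>_. fbar"]
  by (simp add: total_reward_def reward_le path_mem action_mem)

section \<open>The hindsight optimum and weak duality\<close>

definition feasible :: "(nat \<Rightarrow> ('d, 'm) request) \<Rightarrow> (nat \<Rightarrow> real ^ 'd) set" where
  "feasible \<gamma> = {x. (\<forall>t<T. x t \<in> actions (\<gamma> t)) \<and>
    (\<Sum>t<T. consumption (\<gamma> t) (x t)) \<le> real T *\<^sub>R \<rho>}"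

lemma zero_feasible: "\<gamma> \<in> paths \<Longrightarrow> (\<lambda>_. 0) \<in> feasible \<gamma>"
  using resources
  by (auto simp: feasible_def zero_action path_mem less_eq_vec_def less_imp_le)

lemma feasible_reward_le:
  assumes "\<gamma> \<in> paths" "x \<in> feasible \<gamma>"
  shows "(\<Sum>t<T. reward (\<gamma> t) (x t)) \<le> real T * fbar"
  using sum_mono[of "{..<T}" "\<lambda>t. reward (\<gamma> t) (x t)" "\<lambda>_. fbar"] assms
  by (simp add: feasible_def reward_le path_mem)

lemma OPT_leI:
  assumes "\<gamma> \<in> paths" "\<And>x. x \<in> feasible \<gamma> \<Longrightarrow> (\<Sum>t<T. reward (\<gamma> t) (x t)) \<le> c"
  shows "OPT T \<rho> \<gamma> \<le> c"
  unfolding OPT_def feasible_def[symmetric]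
  using zero_feasible[OF assms(1)] assms(2) by (intro cSUP_least) auto

lemma OPT_le: "\<gamma> \<in> paths \<Longrightarrow> OPT T \<rho> \<gamma> \<le> real T * fbar"
  by (intro OPT_leI feasible_reward_le)

lemma OPT_nonneg:
  assumes "\<gamma> \<in> paths"
  shows "0 \<le> OPT T \<rho> \<gamma>"
proof -
  have "0 \<le> (\<Sum>t<T. reward (\<gamma> t) 0)"
    using assms by (auto intro!: sum_nonneg reward_nonneg zero_action path_mem)
  also have "\<dots> \<le> OPT T \<rho> \<gamma>"
    unfolding OPT_def feasible_def[symmetric]
    using zero_feasible feasible_reward_le assms
    by (intro cSUP_upper2[where x = "\<lambda>_. 0"] bdd_aboveI2[where M = "real T * fbar"]) auto
  finally show ?thesis .
qed

text \<open>Each reward is at most the maximal Lagrangian value plus the consumption priced at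
  \<open>\<mu>\<close>, and feasibility caps the total price. One and the same \<open>past\<close>
  can be used for all rounds since only the maximal value matters.\<close>

lemma weak_duality:
  assumes "\<gamma> \<in> paths" "past \<in> lists (space S)" "0 \<le> \<mu>"
  shows "OPT T \<rho> \<gamma> \<le> (\<Sum>s<T. conjugate past \<mu> (\<gamma> s)) + real T * (\<mu> \<bullet> \<rho>)"
proof (rule OPT_leI[OF assms(1)])
  fix x assume x: "x \<in> feasible \<gamma>"
  have "(\<Sum>s<T. reward (\<gamma> s) (x s))
      \<le> (\<Sum>s<T. conjugate past \<mu> (\<gamma> s) + \<mu> \<bullet> consumption (\<gamma> s) (x s))"
  proof (rule sum_mono)
    fix s assume "s \<in> {..<T}"
    then show "reward (\<gamma> s) (x s) \<le> conjugate past \<mu> (\<gamma> s) + \<mu> \<bullet> consumption (\<gamma> s) (x s)"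
      using conjugate_ge[OF assms(2) path_mem[OF assms(1)] assms(3), of s "x s"] x
      by (simp add: feasible_def)
  qed
  also have "\<dots> = (\<Sum>s<T. conjugate past \<mu> (\<gamma> s)) + \<mu> \<bullet> (\<Sum>s<T. consumption (\<gamma> s) (x s))"
    by (simp add: sum.distrib inner_sum_right)
  also have "\<mu> \<bullet> (\<Sum>s<T. consumption (\<gamma> s) (x s)) \<le> \<mu> \<bullet> (real T *\<^sub>R \<rho>)"
    using inner_nonneg[OF assms(3), of "real T *\<^sub>R \<rho> - (\<Sum>s<T. consumption (\<gamma> s) (x s))"] x
    by (simp add: feasible_def inner_diff_right)
  finally show "(\<Sum>s<T. reward (\<gamma> s) (x s))
      \<le> (\<Sum>s<T. conjugate past \<mu> (\<gamma> s)) + real T * (\<mu> \<bullet> \<rho>)"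
    by simp
qed

section \<open>Affordable rounds and the regret along a path\<close>

definition affordable :: "(nat \<Rightarrow> ('d, 'm) request) \<Rightarrow> nat \<Rightarrow> bool" where
  "affordable \<gamma> t \<longleftrightarrow> (\<forall>j. (\<Sum>s<t. consumed \<gamma> s $ j) + bbar \<le> real T * \<rho> $ j)"

lemma consumed_nonneg: "\<gamma> \<in> paths \<Longrightarrow> t < T \<Longrightarrow> 0 \<le> consumed \<gamma> t $ j"
  using consumption_nonneg[of "\<gamma> t" "tentative_at \<gamma> t"] path_mem[of \<gamma> t] tentative_mem[of \<gamma> t]
  by (simp add: less_eq_vec_def)

lemma consumed_le: "\<gamma> \<in> paths \<Longrightarrow> t < T \<Longrightarrow> consumed \<gamma> t $ j \<le> bbar"
  by (intro consumption_le path_mem tentative_mem)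

lemma affordable_antimono:
  assumes "\<gamma> \<in> paths" "s \<le> t" "t \<le> T" "affordable \<gamma> t"
  shows "affordable \<gamma> s"
  unfolding affordable_def
proof
  fix j
  have "(\<Sum>i<s. consumed \<gamma> i $ j) \<le> (\<Sum>i<t. consumed \<gamma> i $ j)"
    using assms by (intro sum_mono2) (auto simp: consumed_nonneg)
  moreover have "(\<Sum>i<t. consumed \<gamma> i $ j) + bbar \<le> real T * \<rho> $ j"
    using assms(4) by (simp add: affordable_def)
  ultimately show "(\<Sum>i<s. consumed \<gamma> i $ j) + bbar \<le> real T * \<rho> $ j"
    by linarith
qed

text \<open>By antimonotonicity all earlier rounds are affordable, so by induction the budget has
  been reduced by exactly the tentative consumptions, and the slack \<open>bbar\<close> covers one
  more tentative action.\<close>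

lemma affordable_action:
  assumes "\<gamma> \<in> paths" "t < T" "affordable \<gamma> t"
  shows "action_at \<gamma> t = tentative_at \<gamma> t"
  using assms(2,3)
proof (induction t rule: less_induct)
  case (less t)
  have "s \<le> t \<Longrightarrow> budget_at \<gamma> s = real T *\<^sub>R \<rho> - (\<Sum>i<s. consumed \<gamma> i)" for s
  proof (induction s)
    case (Suc s)
    have "affordable \<gamma> s"
      using Suc.prems less.prems by (intro affordable_antimono[OF assms(1), of s t]) auto
    then have "action_at \<gamma> s = tentative_at \<gamma> s"
      using Suc.prems less.prems by (intro less.IH) auto
    then have "budget_at \<gamma> (Suc s) = budget_at \<gamma> s - consumed \<gamma> s"
      by simp
    with Suc show ?case
      by (simp del: budget.simps)
  qed simp
  then have "budget_at \<gamma> t = real T *\<^sub>R \<rho> - (\<Sum>i<t. consumed \<gamma> i)"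
    by simp
  moreover have "consumed \<gamma> t $ j \<le> real T * \<rho> $ j - (\<Sum>i<t. consumed \<gamma> i $ j)" for j
  proof -
    have "(\<Sum>i<t. consumed \<gamma> i $ j) + bbar \<le> real T * \<rho> $ j"
      using less.prems by (simp add: affordable_def)
    then show ?thesis
      using consumed_le[OF assms(1) less.prems(1), of j] by linarith
  qed
  ultimately have "consumed \<gamma> t \<le> budget_at \<gamma> t"
    by (simp add: less_eq_vec_def)
  then show ?case
    by (simp add: action_within_def)
qed

lemma affordable_until:
  assumes "\<gamma> \<in> paths"
  obtains n where "n \<le> T" "\<And>t. t < T \<Longrightarrow> affordable \<gamma> t \<longleftrightarrow> t < n"
    "n < T \<Longrightarrow> \<not> affordable \<gamma> n"
proof -
  define n where "n = (LEAST n. n = T \<or> \<not> affordable \<gamma> n)"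
  have n: "n = T \<or> \<not> affordable \<gamma> n"
    unfolding n_def by (rule LeastI[where k = T]) simp
  have le: "n \<le> m" if "m = T \<or> \<not> affordable \<gamma> m" for m
    unfolding n_def using that by (rule Least_le)
  show thesis
  proof (rule that)
    show "n \<le> T" by (rule le) simp
    show "affordable \<gamma> t \<longleftrightarrow> t < n" if "t < T" for t
    proof
      show "t < n" if "affordable \<gamma> t"
        using n affordable_antimono[OF assms _ _ that, of n] \<open>t < T\<close> by force
      show "affordable \<gamma> t" if "t < n"
        using le[of t] that by auto
    qed
    show "n < T \<Longrightarrow> \<not> affordable \<gamma> n"
      using n by auto
  qed
qed

lemma gradient_bound:
  assumes "\<gamma> \<in> paths" "t < T"
  shows "\<bar>(\<rho> - consumed \<gamma> t) $ j\<bar> \<le> bbar + Max (range (\<lambda>j. \<rho> $ j))"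
proof -
  have "\<rho> $ j \<le> Max (range (\<lambda>j. \<rho> $ j))"
    by (rule Max_ge) auto
  then show ?thesis
    using consumed_nonneg[OF assms, of j] consumed_le[OF assms, of j] resources[of j] bbar_nonneg
    unfolding vector_minus_component abs_le_iff by linarith
qed

text \<open>The divergences in the one-step bound telescope.\<close>

lemma regret:
  assumes "\<gamma> \<in> paths" "0 < \<eta>" "0 \<le> \<mu>" "n \<le> T"
  shows "(\<Sum>t<n. (\<rho> - consumed \<gamma> t) \<bullet> (dual_at \<gamma> t - \<mu>))
    \<le> (bregman h \<mu> \<mu>\<^sub>1 - bregman h \<mu> (dual_at \<gamma> n)) / \<eta> + real n * (C2 * \<eta>)"
  using assms(4)
proof (induction n)
  case (Suc n)
  have dual: "dual_at \<gamma> (Suc n) = mirror_step h \<eta> (\<rho> - consumed \<gamma> n) (dual_at \<gamma> n)"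
    by (simp add: tentative_def)
  have "(\<rho> - consumed \<gamma> n) \<bullet> (dual_at \<gamma> n - \<mu>)
      \<le> (bregman h \<mu> (dual_at \<gamma> n) - bregman h \<mu> (dual_at \<gamma> (Suc n))) / \<eta> + C2 * \<eta>"
    unfolding dual C2_def
    using assms Suc.prems by (intro mirror_step_regret dual_smooth gradient_bound) auto
  with Suc show ?case
    by (simp add: diff_divide_distrib algebra_simps del: dual.simps(2))
qed simp

lemma comparator:
  assumes "\<gamma> \<in> paths" "n \<le> T" "n < T \<Longrightarrow> \<not> affordable \<gamma> n"
  obtains \<mu> where "0 \<le> \<mu>" "bregman h \<mu> \<mu>\<^sub>1 \<le> C3"
    "(\<Sum>t<n. (\<rho> - consumed \<gamma> t) \<bullet> \<mu>) \<le> C1 - fbar * (real T - real n)"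
proof -
  have min_pos: "0 < Min (range (\<lambda>j. \<rho> $ j))"
    using resources by simp
  have C1_nonneg: "0 \<le> C1"
    unfolding C1_def
    by (intro divide_nonneg_pos mult_nonneg_nonneg fbar_nonneg bbar_nonneg min_pos)
  have C3_ge: "bregman h \<mu> \<mu>\<^sub>1 \<le> C3"
    if "\<mu> \<in> insert 0 (range (\<lambda>j. (fbar / \<rho> $ j) *\<^sub>R axis j 1))" for \<mu>
    unfolding C3_def using that by (intro Max_ge) auto
  show thesis
  proof (cases "n = T")
    case True
    then show thesis
      using that[of 0] C3_ge[of 0] C1_nonneg by simp
  next
    case False
    then have "\<not> affordable \<gamma> n"
      using assms by simp
    then obtain j where j: "real T * \<rho> $ j < (\<Sum>t<n. consumed \<gamma> t $ j) + bbar"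
      unfolding affordable_def by (auto simp: not_le)
    define \<mu> :: "real ^ 'm" where "\<mu> = (fbar / \<rho> $ j) *\<^sub>R axis j 1"
    have "(\<Sum>t<n. (\<rho> - consumed \<gamma> t) \<bullet> \<mu>) =
        fbar / \<rho> $ j * (real n * \<rho> $ j - (\<Sum>t<n. consumed \<gamma> t $ j))"
      by (simp add: \<mu>_def inner_axis sum_subtractf flip: sum_distrib_left sum_divide_distrib)
    \<comment> \<open>Resource \<open>j\<close> has been consumed beyond
      \<open>real T * \<rho> $ j - bbar\<close> within \<open>n\<close> rounds. The price
      \<open>fbar / \<rho> $ j\<close> converts the shortfall of \<open>real T - real n\<close>
      rounds' worth of this resource into \<open>fbar\<close> per round, with an error of
      \<open>fbar * bbar / \<rho> $ j\<close>.\<close>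
    also have "\<dots> \<le> fbar / \<rho> $ j * (real n * \<rho> $ j - (real T * \<rho> $ j - bbar))"
      using j resources[of j] fbar_nonneg by (intro mult_left_mono) auto
    also have "\<dots> = fbar * bbar / \<rho> $ j - fbar * (real T - real n)"
      using resources[of j] by (simp add: field_simps)
    also have "fbar * bbar / \<rho> $ j \<le> C1"
      unfolding C1_def using fbar_nonneg bbar_nonneg min_pos resources[of j]
      by (intro divide_left_mono) auto
    finally have "(\<Sum>t<n. (\<rho> - consumed \<gamma> t) \<bullet> \<mu>) \<le> C1 - fbar * (real T - real n)"
      by simp
    moreover have "0 \<le> \<mu>"
      using resources[of j] fbar_nonneg by (simp add: \<mu>_def less_eq_vec_def axis_def)
    ultimately show thesis
      using that[of \<mu>] C3_ge[of \<mu>] by (simp add: \<mu>_def)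
  qed
qed

text \<open>The value \<open>fbar\<close> after affordability has failed is what the comparator can
  pay per round, and it dominates the expected optimum per round
  (\<open>expected_OPT_le\<close>).\<close>

definition dual_value :: "(nat \<Rightarrow> ('d, 'm) request) \<Rightarrow> nat \<Rightarrow> real" where
  "dual_value \<gamma> t =
    (if affordable \<gamma> t
     then conjugate (map \<gamma> [0..<t]) (dual_at \<gamma> t) (\<gamma> t) + dual_at \<gamma> t \<bullet> \<rho>
     else fbar)"

lemma dual_value_le_total_reward:
  assumes \<gamma>: "\<gamma> \<in> paths" and \<eta>: "0 < \<eta>"
  shows "(\<Sum>t<T. dual_value \<gamma> t)
    \<le> total_reward sel h \<eta> \<mu>\<^sub>1 \<rho> T \<gamma> + (C1 + C2 * \<eta> * real T + C3 / \<eta>)"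
proof -
  obtain n where n: "n \<le> T" "\<And>t. t < T \<Longrightarrow> affordable \<gamma> t \<longleftrightarrow> t < n"
      "n < T \<Longrightarrow> \<not> affordable \<gamma> n"
    using affordable_until[OF \<gamma>] by blast
  obtain \<mu> where \<mu>: "0 \<le> \<mu>" "bregman h \<mu> \<mu>\<^sub>1 \<le> C3"
      "(\<Sum>t<n. (\<rho> - consumed \<gamma> t) \<bullet> \<mu>) \<le> C1 - fbar * (real T - real n)"
    using comparator[OF \<gamma> n(1,3)] by blast
  have split: "(\<Sum>t<T. f t) = (\<Sum>t<n. f t) + (\<Sum>t\<in>{n..<T}. f t)" for f :: "nat \<Rightarrow> real"
    using sum.atLeastLessThan_concat[of 0 n T f] n(1) by (simp add: lessThan_atLeast0)
  have "(\<Sum>t<T. dual_value \<gamma> t) =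
      (\<Sum>t<n. earned \<gamma> t + (\<rho> - consumed \<gamma> t) \<bullet> dual_at \<gamma> t) + fbar * (real T - real n)"
    using n(1,2)
    by (simp add: split dual_value_def earned_eq_conjugate inner_diff_left inner_commute
        algebra_simps of_nat_diff)
  \<comment> \<open>Writing the iterate as its difference to the comparator plus the comparator
    separates the regret of mirror descent from a term that cancels the \<open>fbar\<close> charged
    for the remaining rounds.\<close>
  also have "\<dots> = (\<Sum>t<n. earned \<gamma> t) + (\<Sum>t<n. (\<rho> - consumed \<gamma> t) \<bullet> (dual_at \<gamma> t - \<mu>))
      + (\<Sum>t<n. (\<rho> - consumed \<gamma> t) \<bullet> \<mu>) + fbar * (real T - real n)"
    by (simp add: sum.distrib sum_subtractf inner_diff_right)
  also have "\<dots> \<le> (\<Sum>t<n. earned \<gamma> t) + (C3 / \<eta> + C2 * \<eta> * real T) + C1"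
  proof -
    have "0 \<le> bregman h \<mu> (dual_at \<gamma> n)"
      using bregman_nonneg[OF dual_smooth] \<mu>(1) by simp
    then have "(bregman h \<mu> \<mu>\<^sub>1 - bregman h \<mu> (dual_at \<gamma> n)) / \<eta> \<le> C3 / \<eta>"
      using \<mu>(2) \<eta> by (intro divide_right_mono) auto
    moreover have "real n * (C2 * \<eta>) \<le> real T * (C2 * \<eta>)"
      using n(1) \<eta> sigma_pos by (intro mult_right_mono) (auto simp: C2_def)
    ultimately show ?thesis
      using regret[OF \<gamma> \<eta> \<mu>(1) n(1)] \<mu>(3) by (simp add: algebra_simps)
  qed
  also have "(\<Sum>t<n. earned \<gamma> t) \<le> total_reward sel h \<eta> \<mu>\<^sub>1 \<rho> T \<gamma>"
  proof -
    have "(\<Sum>t<n. earned \<gamma> t) = (\<Sum>t<n. reward (\<gamma> t) (action_at \<gamma> t))"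
      using n affordable_action[OF \<gamma>] by (intro sum.cong) auto
    moreover have "0 \<le> (\<Sum>t\<in>{n..<T}. reward (\<gamma> t) (action_at \<gamma> t))"
      using \<gamma> by (intro sum_nonneg reward_nonneg path_mem action_mem) auto
    ultimately show ?thesis
      by (simp add: total_reward_def split)
  qed
  finally show ?thesis
    by simp
qed

section \<open>Sign of \<open>C3\<close>, uniform bounds on the dual iterates and
  non-anticipation\<close>

lemma C3_nonneg: "0 \<le> C3"
proof -
  have "bregman h 0 \<mu>\<^sub>1 \<le> C3"
    unfolding C3_def by (intro Max_ge) auto
  then show ?thesis
    using bregman_nonneg[OF initial_dual, of 0] by simp
qed

text \<open>The initial iterate cannot coincide with both of two distinct comparators, and the
  divergence vanishes only at coincidence. For step size zero this makes the right-hand side of the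
  theorem infinite.\<close>

lemma C3_pos:
  assumes "0 < fbar"
  shows "0 < C3"
proof -
  fix j :: 'm
  let ?\<mu> = "(fbar / \<rho> $ j) *\<^sub>R axis j 1 :: real ^ 'm"
  have "bregman h 0 \<mu>\<^sub>1 \<le> C3" "bregman h ?\<mu> \<mu>\<^sub>1 \<le> C3"
    unfolding C3_def by (intro Max_ge; auto)+
  moreover have "0 \<le> ?\<mu>" "?\<mu> \<noteq> 0"
    using assms resources[of j] by (auto simp: less_eq_vec_def axis_def vec_eq_iff)
  ultimately show ?thesis
    using bregman_pos[OF initial_dual, of 0] bregman_pos[OF initial_dual, of ?\<mu>]
    by (cases "\<mu>\<^sub>1 = 0") (auto simp del: scaleR_eq_0_iff)
qed

lemma dual_step_eq:
  "0 < \<eta> \<Longrightarrow>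
    dual_at \<gamma> (Suc t) = prox (grad h (dual_at \<gamma> t) - \<eta> *\<^sub>R (\<rho> - consumed \<gamma> t))"
  by (simp add: mirror_step_eq_prox dual_smooth flip: tentative_def)

text \<open>By the gradient inequality \<open>\<nu>\<close> minimizes \<open>h\<close> tilted by its
  own gradient, and minimizers are unique. A mirror step thus becomes a difference of two values of
  \<open>prox\<close>, to which the Lipschitz bound applies.\<close>

lemma prox_grad:
  assumes "\<nu> \<in> smooth"
  shows "prox (grad h \<nu>) = \<nu>"
  using prox_strict[of \<nu> "grad h \<nu>"] smooth_orthant[OF assms]
    grad_monotone[OF assms smooth_orthant[OF prox_smooth], of "grad h \<nu>"]
  by (force simp: inner_diff_right)

text \<open>Each step is at most \<open>\<eta> / \<sigma>\<close> times the norm of a bounded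
  gradient. The bound is uniform over paths, which gives integrability of the dual values.\<close>

lemma dual_bounded:
  assumes "0 < \<eta>" "t \<le> T"
  obtains B where "\<And>\<gamma>. \<gamma> \<in> paths \<Longrightarrow> norm (dual_at \<gamma> t) \<le> B"
proof -
  have "\<exists>B. \<forall>\<gamma>\<in>paths. norm (dual_at \<gamma> t) \<le> B"
    using assms(2)
  proof (induction t)
    case (Suc t)
    then obtain B where B: "\<And>\<gamma>. \<gamma> \<in> paths \<Longrightarrow> norm (dual_at \<gamma> t) \<le> B"
      by auto
    let ?G = "real CARD('m) * (bbar + Max (range (\<lambda>j. \<rho> $ j)))"
    have "norm (dual_at \<gamma> (Suc t)) \<le> \<eta> * ?G / \<sigma> + B" if \<gamma>: "\<gamma> \<in> paths" for \<gamma>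
    proof -
      have "norm (\<rho> - consumed \<gamma> t) \<le> ?G"
        using norm_le_norm_1[of "\<rho> - consumed \<gamma> t"] gradient_bound[OF \<gamma>, of t] Suc.prems
          sum_bounded_above[of UNIV "\<lambda>j. \<bar>(\<rho> - consumed \<gamma> t) $ j\<bar>"]
        unfolding norm_1_def by fastforce
      moreover have "\<sigma> * norm (dual_at \<gamma> (Suc t) - dual_at \<gamma> t) \<le> \<eta> * norm (\<rho> - consumed \<gamma> t)"
        using prox_Lipschitz[of "grad h (dual_at \<gamma> t) - \<eta> *\<^sub>R (\<rho> - consumed \<gamma> t)" "grad h (dual_at \<gamma> t)"]
          assms(1)
        unfolding dual_step_eq[OF assms(1)] prox_grad[OF dual_smooth] by simp
      ultimately have "\<sigma> * norm (dual_at \<gamma> (Suc t) - dual_at \<gamma> t) \<le> \<eta> * ?G"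
        using assms(1) by (meson mult_left_mono less_imp_le order_trans)
      then have "norm (dual_at \<gamma> (Suc t) - dual_at \<gamma> t) \<le> \<eta> * ?G / \<sigma>"
        using sigma_pos by (simp add: pos_le_divide_eq mult.commute)
      then show ?thesis
        using norm_triangle_sub[of "dual_at \<gamma> (Suc t)" "dual_at \<gamma> t"] B[OF \<gamma>] by linarith
    qed
    then show ?case by blast
  qed auto
  with that show thesis by blast
qed

text \<open>Non-anticipation, which permits integrating over the current request with the iterate
  frozen.\<close>

lemma dual_cong: "(\<And>s. s < t \<Longrightarrow> \<gamma> s = \<gamma>' s) \<Longrightarrow> dual_at \<gamma> t = dual_at \<gamma>' t"
proof (induction t)
  case (Suc t)
  have "map \<gamma> [0..<t] = map \<gamma>' [0..<t]" "dual_at \<gamma> t = dual_at \<gamma>' t" "\<gamma> t = \<gamma>' t"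
    using Suc by auto
  then show ?case
    unfolding dual.simps by (simp only:)
qed simp

lemma tentative_cong:
  assumes "\<And>s. s \<le> t \<Longrightarrow> \<gamma> s = \<gamma>' s"
  shows "tentative_at \<gamma> t = tentative_at \<gamma>' t"
proof -
  have "map \<gamma> [0..<t] = map \<gamma>' [0..<t]" "dual_at \<gamma> t = dual_at \<gamma>' t" "\<gamma> t = \<gamma>' t"
    using assms by (auto intro: dual_cong)
  then show ?thesis
    unfolding tentative_def by (simp only:)
qed

lemma affordable_cong:
  assumes "\<And>s. s < t \<Longrightarrow> \<gamma> s = \<gamma>' s"
  shows "affordable \<gamma> t \<longleftrightarrow> affordable \<gamma>' t"
proof -
  have "consumed \<gamma> s = consumed \<gamma>' s" if "s < t" for s
    using tentative_cong[of s \<gamma> \<gamma>'] assms that by simp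
  then show ?thesis
    by (simp add: affordable_def)
qed

end

section \<open>Expectations under independent requests\<close>

lemma abs_measure_diff_le_tv_dist:
  assumes "prob_space P" "prob_space Q" "A \<in> sets P"
  shows "\<bar>measure P A - measure Q A\<bar> \<le> tv_dist P Q"
  unfolding tv_dist_def
\<comment> \<open>A real supremum is meaningful only for a bounded set; differences of probabilities
  are bounded by 1.\<close>
proof (rule cSUP_upper[OF assms(3)], rule bdd_aboveI2)
  fix B
  show "\<bar>measure P B - measure Q B\<bar> \<le> 1"
    using prob_space.prob_le_1[OF assms(1), of B] prob_space.prob_le_1[OF assms(2), of B]
      measure_nonneg[of P B] measure_nonneg[of Q B]
    by linarith
qed

lemma tv_dist_nonneg: "prob_space P \<Longrightarrow> prob_space Q \<Longrightarrow> 0 \<le> tv_dist P Q"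
  using abs_measure_diff_le_tv_dist[of P Q "{}"] by simp

text \<open>
  A function with values in \<open>[0, c]\<close> lies within \<open>c / n\<close> of \<open>c / n\<close> times the number of its
  superlevel sets \<open>{c k / n \<le> \<phi>}\<close>, \<open>1 \<le> k \<le> n\<close>, that contain the argument, and the
  measures of each of these sets differ by at most the total variation distance.
\<close>

lemma integral_le_tv_dist:
  fixes \<phi> :: "'a \<Rightarrow> real"
  assumes "prob_space P" "prob_space Q" and sets: "sets Q = sets P"
    and \<phi>: "\<phi> \<in> borel_measurable P"
    and bounds: "\<And>x. x \<in> space P \<Longrightarrow> 0 \<le> \<phi> x" "\<And>x. x \<in> space P \<Longrightarrow> \<phi> x \<le> c"
    and c: "0 \<le> c"
  shows "(\<integral>x. \<phi> x \<partial>Q) \<le> (\<integral>x. \<phi> x \<partial>P) + c * tv_dist P Q"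
proof (cases "c = 0")
  case True
  have "space Q = space P"
    using sets by (rule sets_eq_imp_space_eq)
  moreover have "\<phi> x = 0" if "x \<in> space P" for x
    using bounds[OF that] True by simp
  ultimately have "(\<integral>x. \<phi> x \<partial>Q) = 0" "(\<integral>x. \<phi> x \<partial>P) = 0"
    by (auto intro!: integral_eq_zero_AE AE_I2)
  then show ?thesis
    using True by simp
next
  case False
  with c have c: "0 < c" by simp
  interpret P: prob_space P by fact
  interpret Q: prob_space Q by fact
  have space: "space Q = space P"
    using sets by (rule sets_eq_imp_space_eq)
  have tv: "measure Q A \<le> measure P A + tv_dist P Q" if "A \<in> sets P" for A
    using abs_measure_diff_le_tv_dist[OF assms(1,2) that] by linarith
  have approx: "(\<integral>x. \<phi> x \<partial>Q) \<le> (\<integral>x. \<phi> x \<partial>P) + c * tv_dist P Q + c / real (Suc m)" for m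
  proof -
    let ?n = "Suc m"
    define A where "A k = {x \<in> space P. c / real ?n * real k \<le> \<phi> x}" for k :: nat
    have A: "A k \<in> sets P" for k
      unfolding A_def using \<phi> by measurable
    define \<phi>' where "\<phi>' x = c / real ?n * (\<Sum>k=1..?n. indicator (A k) x)" for x
    have step: "\<phi>' x \<le> \<phi> x \<and> \<phi> x \<le> \<phi>' x + c / real ?n" if x: "x \<in> space P" for x
    proof -
      \<comment> \<open>Rescaled to the range from 0 to \<open>?n\<close>, the value has as its
        floor the number of superlevel sets that contain \<open>x\<close>.\<close>
      define z where "z = \<phi> x * real ?n / c"
      have z: "0 \<le> z" "z \<le> real ?n"
        using bounds[OF x] c by (auto simp: z_def pos_divide_le_eq mult.commute mult_right_mono)
      define i where "i = nat \<lfloor>z\<rfloor>"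
      have i: "real i \<le> z" "z < real i + 1" "i \<le> ?n"
        using z by (auto simp: i_def nat_le_iff floor_le_iff)
      have "indicator (A k) x = (if k \<le> i then 1 else 0 :: real)" for k
      proof -
        have "c / real ?n * real k \<le> \<phi> x \<longleftrightarrow> real k \<le> z"
          using c by (simp add: z_def field_simps del: of_nat_Suc)
        also have "\<dots> \<longleftrightarrow> k \<le> i"
          using z by (simp add: i_def le_nat_iff le_floor_iff)
        finally show ?thesis
          using x by (simp add: A_def indicator_def)
      qed
      then have "(\<Sum>k=1..?n. indicator (A k) x) = (\<Sum>k=1..?n. if k \<le> i then 1 else 0 :: real)"
        by simp
      also have "\<dots> = real (card ({1..?n} \<inter> {k. k \<le> i}))"
        by (simp add: sum.If_cases del: sum.cl_ivl_Suc)
      also have "{1..?n} \<inter> {k. k \<le> i} = {1..i}"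
        using i(3) by auto
      finally have "\<phi>' x = c / real ?n * real i"
        by (simp add: \<phi>'_def)
      moreover have "\<phi> x = c / real ?n * z"
        using c by (simp add: z_def)
      moreover have "c / real ?n * z \<le> c / real ?n * (real i + 1)"
        using i c by (intro mult_left_mono) auto
      moreover have "c / real ?n * real i \<le> c / real ?n * z"
        using i c by (intro mult_left_mono) auto
      ultimately show ?thesis
        by (simp add: distrib_left)
    qed
    have int_P: "integrable P \<phi>" and int_Q: "integrable Q \<phi>"
      using \<phi> bounds measurable_cong_sets[OF sets refl]
      by (auto intro!: P.integrable_const_bound[where B = c] Q.integrable_const_bound[where B = c]
          AE_I2 simp: space)
    have int_\<phi>'_P: "integrable P \<phi>'" and int_\<phi>'_Q: "integrable Q \<phi>'"
      unfolding \<phi>'_def using A sets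
      by (auto intro!: integrable_mult_right Bochner_Integration.integrable_sum
          simp: P.emeasure_eq_measure Q.emeasure_eq_measure)
    have val_P: "(\<integral>x. \<phi>' x \<partial>P) = c / real ?n * (\<Sum>k=1..?n. measure P (A k))"
      and val_Q: "(\<integral>x. \<phi>' x \<partial>Q) = c / real ?n * (\<Sum>k=1..?n. measure Q (A k))"
      unfolding \<phi>'_def using A sets
      by (simp_all add: P.emeasure_eq_measure Q.emeasure_eq_measure Int_absorb2[OF sets.sets_into_space])
    have "(\<integral>x. \<phi> x \<partial>Q) \<le> (\<integral>x. \<phi>' x + c / real ?n \<partial>Q)"
      using int_Q int_\<phi>'_Q step by (intro integral_mono) (auto simp: space)
    also have "\<dots> = c / real ?n * (\<Sum>k=1..?n. measure Q (A k)) + c / real ?n"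
      using int_\<phi>'_Q val_Q by (simp add: Q.prob_space)
    also have "\<dots> \<le> c / real ?n * (\<Sum>k=1..?n. measure P (A k) + tv_dist P Q) + c / real ?n"
      using c tv[OF A] by (intro add_right_mono mult_left_mono sum_mono) auto
    also have "\<dots> = (\<integral>x. \<phi>' x \<partial>P) + c * tv_dist P Q + c / real ?n"
      unfolding val_P by (simp add: sum.distrib distrib_left del: of_nat_Suc)
    also have "(\<integral>x. \<phi>' x \<partial>P) \<le> (\<integral>x. \<phi> x \<partial>P)"
      using int_P int_\<phi>'_P step by (intro integral_mono) auto
    finally show ?thesis by simp
  qed
  have "(\<lambda>m. (\<integral>x. \<phi> x \<partial>P) + c * tv_dist P Q + c * inverse (real (Suc m)))
      \<longlonglongrightarrow> (\<integral>x. \<phi> x \<partial>P) + c * tv_dist P Q + c * 0"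
    by (intro tendsto_intros LIMSEQ_inverse_real_of_nat)
  then have "(\<integral>x. \<phi> x \<partial>Q) \<le> (\<integral>x. \<phi> x \<partial>P) + c * tv_dist P Q + c * 0"
    by (rule LIMSEQ_le_const) (use approx in \<open>auto simp: divide_inverse simp del: of_nat_Suc\<close>)
  then show ?thesis by simp
qed

text \<open>Every map into probability measures is measurable on the finite index space, so
  \<open>integral_bind\<close> applies to a bounded function and leaves an average over the
  rounds.\<close>

lemma mean_distribution:
  fixes \<phi> :: "'a \<Rightarrow> real"
  assumes T: "T \<ge> 1" and P: "\<And>t. t < T \<Longrightarrow> P t \<in> space (prob_algebra S)"
  shows prob_space_mean_distribution: "prob_space (mean_distribution T P)"
    and sets_mean_distribution: "sets (mean_distribution T P) = sets S"
    and integral_mean_distribution: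
      "\<phi> \<in> borel_measurable S \<Longrightarrow> (\<And>x. x \<in> space S \<Longrightarrow> \<bar>\<phi> x\<bar> \<le> c) \<Longrightarrow>
        (\<integral>x. \<phi> x \<partial>mean_distribution T P) = (\<Sum>t<T. \<integral>x. \<phi> x \<partial>P t) / real T"
proof -
  let ?U = "uniform_count_measure {..<T}"
  have "{..<T} \<noteq> {}"
    using T by (auto simp: lessThan_empty_iff)
  then interpret U: prob_space ?U
    by (intro prob_space_uniform_count_measure) auto
  have meas: "P \<in> ?U \<rightarrow>\<^sub>M prob_algebra S"
    using P by (auto simp: measurable_def space_uniform_count_measure sets_uniform_count_measure)
  have "mean_distribution T P \<in> space (prob_algebra S)"
    unfolding mean_distribution_def using meas U.prob_space_axioms
    using prob_space_bind'[of ?U ?U P S] sets_bind'[of ?U ?U P S] by (simp add: space_prob_algebra)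
  then show "prob_space (mean_distribution T P)" "sets (mean_distribution T P) = sets S"
    by (auto simp: space_prob_algebra)
  assume \<phi>: "\<phi> \<in> borel_measurable S" "\<And>x. x \<in> space S \<Longrightarrow> \<bar>\<phi> x\<bar> \<le> c"
  have "(\<integral>x. \<phi> x \<partial>mean_distribution T P) = (\<integral>t. \<integral>x. \<phi> x \<partial>P t \<partial>?U)"
    unfolding mean_distribution_def
  proof (rule integral_bind[where K = S and B = c and B' = 1])
    show "P \<in> ?U \<rightarrow>\<^sub>M subprob_algebra S"
      using meas by (rule measurable_prob_algebraD)
    show "finite_measure ?U"
      by unfold_locales
    show "AE t in ?U. emeasure (P t) (space (P t)) \<le> ennreal 1"
      using P by (intro AE_I2)
        (auto simp: space_uniform_count_measure space_prob_algebra prob_space.emeasure_space_1)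
  qed (use \<phi> in auto)
  also have "\<dots> = (\<Sum>t<T. \<integral>x. \<phi> x \<partial>P t) / real T"
    by (simp add: integral_uniform_count_measure)
  finally show "(\<integral>x. \<phi> x \<partial>mean_distribution T P) = (\<Sum>t<T. \<integral>x. \<phi> x \<partial>P t) / real T" .
qed

section \<open>Measurability and integrability of the dual values\<close>

locale stochastic_allocation = allocation h \<sigma> S sel \<eta> fbar bbar \<mu>\<^sub>1 \<rho> T
  for h :: "real ^ 'm::finite \<Rightarrow> real" and \<sigma> :: real
    and S :: "('d::finite, 'm) request measure"
    and sel :: "('d, 'm) selection"
    and \<eta> fbar bbar :: real
    and \<mu>\<^sub>1 \<rho> :: "real ^ 'm"
    and T :: nat +
  fixes P :: "nat \<Rightarrow> ('d, 'm) request measure"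
  assumes horizon: "T \<ge> 1"
    and eta_pos: "0 < \<eta>"
    and P: "\<And>t. P t \<in> space (prob_algebra S)"
    and measurable_OPT: "OPT T \<rho> \<in> borel_measurable (PiM {..<T} (\<lambda>_. S))"
    and measurable_total_reward:
      "total_reward sel h \<eta> \<mu>\<^sub>1 \<rho> T \<in> borel_measurable (PiM {..<T} (\<lambda>_. S))"
    and measurable_earned:
      "\<And>t. t < T \<Longrightarrow> (\<lambda>\<gamma>. earned \<gamma> t) \<in> borel_measurable (PiM {..<T} (\<lambda>_. S))"
    and measurable_consumed:
      "\<And>t. t < T \<Longrightarrow> (\<lambda>\<gamma>. consumed \<gamma> t) \<in> borel_measurable (PiM {..<T} (\<lambda>_. S))"
begin

abbreviation \<Omega> :: "(nat \<Rightarrow> ('d, 'm) request) measure" where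
  "\<Omega> \<equiv> PiM {..<T} P"

lemma prob_space_P: "prob_space (P t)" and sets_P: "sets (P t) = sets S"
  using P by (auto simp: space_prob_algebra)

lemma space_P: "space (P t) = space S"
  using sets_P by (rule sets_eq_imp_space_eq)

sublocale product: product_sigma_finite P
  by (intro product_sigma_finite.intro prob_space_imp_sigma_finite prob_space_P)

sublocale Omega: prob_space \<Omega>
  by (intro prob_space_PiM prob_space_P)

lemma sets_Omega: "sets \<Omega> = sets (PiM {..<T} (\<lambda>_. S))"
  by (intro sets_PiM_cong refl sets_P)

lemma space_Omega: "\<gamma> \<in> space \<Omega> \<Longrightarrow> \<gamma> \<in> paths"
  by (auto simp: space_PiM space_P paths_def)

lemmas measurable_Omega = measurable_cong_sets[OF sets_Omega refl]

text \<open>Only the consumption is assumed measurable; the iterates inherit this inductively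
  through the measurable gradient and the continuous \<open>prox\<close>.\<close>

lemma borel_measurable_dual: "t \<le> T \<Longrightarrow> (\<lambda>\<gamma>. dual_at \<gamma> t) \<in> borel_measurable \<Omega>"
proof (induction t)
  case (Suc t)
  then have "(\<lambda>\<gamma>. grad h (dual_at \<gamma> t)) \<in> borel_measurable \<Omega>"
    by (intro borel_measurable_grad dual_smooth) auto
  moreover have "(\<lambda>\<gamma>. consumed \<gamma> t) \<in> borel_measurable \<Omega>"
    using measurable_consumed[of t] Suc.prems by (simp add: measurable_Omega)
  ultimately show ?case
    unfolding dual_step_eq[OF eta_pos]
    by (intro measurable_compose[OF _ borel_measurable_prox] borel_measurable_diff
        borel_measurable_scaleR borel_measurable_const)
qed simp

lemma borel_measurable_dual_value:
  assumes "t < T"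
  shows "(\<lambda>\<gamma>. dual_value \<gamma> t) \<in> borel_measurable \<Omega>"
proof -
  have consumed [measurable]: "(\<lambda>\<gamma>. consumed \<gamma> s) \<in> borel_measurable \<Omega>" if "s \<le> t" for s
    using measurable_consumed[of s] that assms by (simp add: measurable_Omega)
  have [measurable]: "(\<lambda>\<gamma>. consumed \<gamma> s $ j) \<in> borel_measurable \<Omega>" if "s \<in> {..<t}" for s j
  proof -
    have "(\<lambda>\<gamma>. consumed \<gamma> s \<bullet> axis j 1) \<in> borel_measurable \<Omega>"
      using consumed[of s] that by (intro borel_measurable_inner) auto
    then show ?thesis by (simp add: inner_axis)
  qed
  have [measurable]: "Measurable.pred \<Omega> (\<lambda>\<gamma>. affordable \<gamma> t)"
    unfolding affordable_def by measurable
  have dual [measurable]: "(\<lambda>\<gamma>. dual_at \<gamma> t) \<in> borel_measurable \<Omega>"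
    using assms by (intro borel_measurable_dual) simp
  have [measurable]: "(\<lambda>\<gamma>. earned \<gamma> t) \<in> borel_measurable \<Omega>"
    using measurable_earned[OF assms] by (simp add: measurable_Omega)
  have [measurable]: "(\<lambda>\<gamma>. dual_at \<gamma> t \<bullet> consumed \<gamma> t) \<in> borel_measurable \<Omega>"
    using consumed[of t] dual by (intro borel_measurable_inner) auto
  \<comment> \<open>The conjugate is rewritten through \<open>earned\<close> and
    \<open>consumed\<close>, for which measurability is available.\<close>
  have "(\<lambda>\<gamma>. if affordable \<gamma> t
      then earned \<gamma> t - dual_at \<gamma> t \<bullet> consumed \<gamma> t + dual_at \<gamma> t \<bullet> \<rho> else fbar) \<in> borel_measurable \<Omega>"
    by measurable
  also have "(\<lambda>\<gamma>. if affordable \<gamma> t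
      then earned \<gamma> t - dual_at \<gamma> t \<bullet> consumed \<gamma> t + dual_at \<gamma> t \<bullet> \<rho> else fbar) =
      (\<lambda>\<gamma>. dual_value \<gamma> t)"
    by (simp add: fun_eq_iff dual_value_def earned_eq_conjugate[of _ t])
  finally show ?thesis .
qed

lemma integrable_bounded:
  fixes f :: "(nat \<Rightarrow> ('d, 'm) request) \<Rightarrow> real"
  assumes "f \<in> borel_measurable \<Omega>" "\<And>\<gamma>. \<gamma> \<in> paths \<Longrightarrow> \<bar>f \<gamma>\<bar> \<le> c"
  shows "integrable \<Omega> f"
  using assms space_Omega by (intro Omega.integrable_const_bound[where B = c] AE_I2) auto

lemma dual_value_bounded:
  assumes "t < T"
  obtains c where "\<And>\<gamma>. \<gamma> \<in> paths \<Longrightarrow> \<bar>dual_value \<gamma> t\<bar> \<le> c"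
proof -
  obtain B where B: "\<And>\<gamma>. \<gamma> \<in> paths \<Longrightarrow> norm (dual_at \<gamma> t) \<le> B"
    using dual_bounded[OF eta_pos, of t] assms by auto
  have "\<bar>dual_value \<gamma> t\<bar> \<le> fbar + B * norm \<rho>" if \<gamma>: "\<gamma> \<in> paths" for \<gamma>
  proof -
    have "\<bar>dual_at \<gamma> t \<bullet> \<rho>\<bar> \<le> norm (dual_at \<gamma> t) * norm \<rho>"
      by (rule Cauchy_Schwarz_ineq2)
    also have "\<dots> \<le> B * norm \<rho>"
      by (intro mult_right_mono B \<gamma>) simp
    finally show ?thesis
      using conjugate_bounds[OF past_mem[OF \<gamma>] path_mem[OF \<gamma>] dual_nonneg, of t t \<gamma> t] assms
        fbar_nonneg
      by (auto simp: dual_value_def)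
  qed
  then show thesis by (rule that)
qed

lemma integrable_dual_value: "t < T \<Longrightarrow> integrable \<Omega> (\<lambda>\<gamma>. dual_value \<gamma> t)"
  by (rule dual_value_bounded, assumption)
    (rule integrable_bounded[OF borel_measurable_dual_value])

text \<open>Inserting coordinate \<open>t\<close> is a measurable map from the product of the other
  coordinates with \<open>P t\<close>. The bounded dual value is therefore integrable there, and
  Fubini applies.\<close>

lemma integrable_inner_dual_value:
  assumes "t < T"
  shows "integrable (PiM ({..<T} - {t}) P) (\<lambda>x. \<integral>y. dual_value (x(t := y)) t \<partial>P t)"
proof -
  let ?I = "{..<T} - {t}"
  interpret I: prob_space "PiM ?I P"
    by (intro prob_space_PiM prob_space_P)
  interpret t: prob_space "P t"
    by (rule prob_space_P)
  interpret pair: pair_prob_space "PiM ?I P" "P t" ..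
  have I: "insert t ?I = {..<T}"
    using assms by auto
  obtain c where c: "\<And>\<gamma>. \<gamma> \<in> paths \<Longrightarrow> \<bar>dual_value \<gamma> t\<bar> \<le> c"
    using dual_value_bounded[OF assms] by blast
  have upd: "(\<lambda>(x, y). x(t := y)) \<in> PiM ?I P \<Otimes>\<^sub>M P t \<rightarrow>\<^sub>M \<Omega>"
    using measurable_add_dim[of t ?I P] unfolding I .
  have "integrable (PiM ?I P \<Otimes>\<^sub>M P t) (\<lambda>xy. dual_value ((\<lambda>(x, y). x(t := y)) xy) t)"
  proof (rule pair.integrable_const_bound[where B = c])
    show "AE xy in PiM ?I P \<Otimes>\<^sub>M P t. norm (dual_value ((\<lambda>(x, y). x(t := y)) xy) t) \<le> c"
      using c[OF space_Omega[OF measurable_space[OF upd]]] by (intro AE_I2) simp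
  qed (rule measurable_compose[OF upd borel_measurable_dual_value[OF assms]])
  then show ?thesis
    using pair.integrable_fst'[of "\<lambda>xy. dual_value ((\<lambda>(x, y). x(t := y)) xy) t"] by simp
qed

lemma integrable_OPT: "integrable \<Omega> (OPT T \<rho>)"
  using measurable_OPT OPT_nonneg OPT_le
  by (intro integrable_bounded[where c = "real T * fbar"]) (auto simp: measurable_Omega)

lemma integrable_total_reward: "integrable \<Omega> (total_reward sel h \<eta> \<mu>\<^sub>1 \<rho> T)"
  using measurable_total_reward total_reward_nonneg total_reward_le
  by (intro integrable_bounded[where c = "real T * fbar"]) (auto simp: measurable_Omega)

section \<open>Expected dual values against the expected optimum\<close>

lemma expected_OPT_le: "(\<integral>\<gamma>. OPT T \<rho> \<gamma> \<partial>\<Omega>) / real T \<le> fbar"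
proof -
  have "(\<integral>\<gamma>. OPT T \<rho> \<gamma> \<partial>\<Omega>) \<le> (\<integral>\<gamma>. real T * fbar \<partial>\<Omega>)"
    using OPT_le space_Omega by (intro integral_mono integrable_OPT) auto
  then show ?thesis
    using horizon by (simp add: Omega.prob_space pos_divide_le_eq mult.commute)
qed

text \<open>With \<open>past\<close> and \<open>\<mu>\<close> fixed, taking expectations in weak
  duality leaves only the marginals \<open>P s\<close>, whose contributions add up to
  \<open>T\<close> times the expectation under the mean distribution. Passing to \<open>P t\<close>
  costs \<open>fbar\<close> times the distance because the conjugate takes values between 0 and
  \<open>fbar\<close>.\<close>

lemma expected_conjugate_ge:
  assumes past: "past \<in> lists (space S)" and \<mu>: "0 \<le> \<mu>" and t: "t < T"
    and meas: "conjugate past \<mu> \<in> borel_measurable S"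
  shows "(\<integral>\<gamma>. OPT T \<rho> \<gamma> \<partial>\<Omega>) / real T - fbar * tv_dist (P t) (mean_distribution T P)
    \<le> (\<integral>y. conjugate past \<mu> y \<partial>P t) + \<mu> \<bullet> \<rho>"
proof -
  let ?\<phi> = "conjugate past \<mu>"
  have bounds: "\<And>y. y \<in> space S \<Longrightarrow> 0 \<le> ?\<phi> y" "\<And>y. y \<in> space S \<Longrightarrow> ?\<phi> y \<le> fbar"
    using conjugate_bounds[OF past _ \<mu>] by auto
  have component: "(\<lambda>\<gamma>. \<gamma> s) \<in> \<Omega> \<rightarrow>\<^sub>M P s" if "s < T" for s
    using that by (intro measurable_component_singleton) simp
  have meas_P: "?\<phi> \<in> borel_measurable (P s)" for s
    using meas by (simp add: measurable_cong_sets[OF sets_P refl])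
  have int: "integrable \<Omega> (\<lambda>\<gamma>. ?\<phi> (\<gamma> s))" if "s < T" for s
    using that bounds path_mem
    by (intro integrable_bounded[where c = fbar] measurable_compose[OF component meas_P]) auto
  have "(\<integral>\<gamma>. OPT T \<rho> \<gamma> \<partial>\<Omega>) \<le> (\<integral>\<gamma>. (\<Sum>s<T. ?\<phi> (\<gamma> s)) + real T * (\<mu> \<bullet> \<rho>) \<partial>\<Omega>)"
    using weak_duality[OF _ past \<mu>] space_Omega int
    by (intro integral_mono integrable_OPT Bochner_Integration.integrable_add Omega.integrable_const
        Bochner_Integration.integrable_sum) auto
  also have "\<dots> = (\<integral>\<gamma>. (\<Sum>s<T. ?\<phi> (\<gamma> s)) \<partial>\<Omega>) + real T * (\<mu> \<bullet> \<rho>)"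
    using int
    by (subst Bochner_Integration.integral_add)
      (auto intro!: Bochner_Integration.integrable_sum simp: Omega.prob_space)
  also have "(\<integral>\<gamma>. (\<Sum>s<T. ?\<phi> (\<gamma> s)) \<partial>\<Omega>) = (\<Sum>s<T. \<integral>\<gamma>. ?\<phi> (\<gamma> s) \<partial>\<Omega>)"
    using int by (intro Bochner_Integration.integral_sum) simp
  also have "(\<Sum>s<T. \<integral>\<gamma>. ?\<phi> (\<gamma> s) \<partial>\<Omega>) = (\<Sum>s<T. \<integral>y. ?\<phi> y \<partial>P s)"
  proof (rule sum.cong)
    fix s assume s: "s \<in> {..<T}"
    have "distr \<Omega> (P s) (\<lambda>\<gamma>. \<gamma> s) = P s"
      using s by (intro distr_PiM_component prob_space_P)
    then show "(\<integral>\<gamma>. ?\<phi> (\<gamma> s) \<partial>\<Omega>) = (\<integral>y. ?\<phi> y \<partial>P s)"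
      using integral_distr[OF component meas_P[of s]] s by simp
  qed simp
  also have "\<dots> = real T * (\<integral>y. ?\<phi> y \<partial>mean_distribution T P)"
    using integral_mean_distribution[OF horizon P meas, of fbar] bounds horizon by simp
  finally have "(\<integral>\<gamma>. OPT T \<rho> \<gamma> \<partial>\<Omega>) / real T \<le> (\<integral>y. ?\<phi> y \<partial>mean_distribution T P) + \<mu> \<bullet> \<rho>"
    using horizon by (simp add: pos_divide_le_eq algebra_simps)
  also have "(\<integral>y. ?\<phi> y \<partial>mean_distribution T P)
      \<le> (\<integral>y. ?\<phi> y \<partial>P t) + fbar * tv_dist (P t) (mean_distribution T P)"
    using prob_space_mean_distribution[OF horizon P] sets_mean_distribution[OF horizon P]
      bounds fbar_nonneg meas_P
    by (intro integral_le_tv_dist prob_space_P) (auto simp: sets_P space_P)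
  finally show ?thesis
    by simp
qed

text \<open>Independence allows the request of round \<open>t\<close> to be integrated first, with
  all other requests held fixed in \<open>x\<close>. The past, the iterate and affordability do not
  react to it, so the bound for a fixed past applies, and it is then averaged over
  \<open>x\<close>.\<close>

lemma expected_dual_value_ge:
  assumes t: "t < T"
  shows "(\<integral>\<gamma>. OPT T \<rho> \<gamma> \<partial>\<Omega>) / real T - fbar * tv_dist (P t) (mean_distribution T P)
    \<le> (\<integral>\<gamma>. dual_value \<gamma> t \<partial>\<Omega>)"
    (is "?c \<le> _")
proof -
  let ?I = "{..<T} - {t}"
  have I: "insert t ?I = {..<T}" "finite ?I" "t \<notin> ?I"
    using t by auto
  interpret pair: prob_space "PiM ?I P"
    by (intro prob_space_PiM prob_space_P)
  have inner: "?c \<le> (\<integral>y. dual_value (x(t := y)) t \<partial>P t)" if x: "x \<in> space (PiM ?I P)" for x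
  proof -
    let ?past = "map x [0..<t]" and ?\<mu> = "dual_at x t"
    have past: "?past \<in> lists (space S)"
      using x t by (auto simp: space_PiM space_P PiE_iff in_lists_conv_set)
    have upd: "map (x(t := y)) [0..<t] = ?past" "dual_at (x(t := y)) t = ?\<mu>"
      "affordable (x(t := y)) t \<longleftrightarrow> affordable x t" for y
      by (auto intro: dual_cong simp: affordable_cong[of t "x(t := y)" x])
    have tent: "tentative_at (x(t := y)) t = sel ?past y ?\<mu>" for y
      unfolding tentative_def upd by simp
    have "x \<in> space (PiM ?I (\<lambda>_. S))"
      using x by (simp add: space_PiM space_P)
    then have meas_upd: "(\<lambda>y. x(t := y)) \<in> S \<rightarrow>\<^sub>M PiM {..<T} (\<lambda>_. S)"
      using I(1) by (intro measurable_fun_upd[where J = ?I]) auto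
    \<comment> \<open>Freezing all other coordinates turns measurability of the algorithm's rewards
      and consumptions into measurability in the current request alone.\<close>
    have "(\<lambda>y. earned (x(t := y)) t) \<in> borel_measurable S"
      "(\<lambda>y. consumed (x(t := y)) t) \<in> borel_measurable S"
      using measurable_compose[OF meas_upd measurable_earned[OF t]]
        measurable_compose[OF meas_upd measurable_consumed[OF t]] by auto
    then have meas: "conjugate ?past ?\<mu> \<in> borel_measurable S"
      unfolding conjugate_def tent fun_upd_same by measurable
    have "(\<integral>y. dual_value (x(t := y)) t \<partial>P t) =
        (\<integral>y. (if affordable x t then conjugate ?past ?\<mu> y + ?\<mu> \<bullet> \<rho> else fbar) \<partial>P t)"
      unfolding dual_value_def upd fun_upd_same by (rule refl)
    also have "?c \<le> \<dots>"
    proof (cases "affordable x t")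
      case True
      interpret Pt: prob_space "P t" by (rule prob_space_P)
      have "integrable (P t) (conjugate ?past ?\<mu>)"
        using conjugate_bounds[OF past _ dual_nonneg] meas
        by (intro Pt.integrable_const_bound[where B = fbar] AE_I2)
          (auto simp: space_P measurable_cong_sets[OF sets_P refl])
      then show ?thesis
        using expected_conjugate_ge[OF past dual_nonneg t meas] True
        by (simp add: Pt.prob_space)
    next
      case False
      interpret Pt: prob_space "P t" by (rule prob_space_P)
      have "0 \<le> tv_dist (P t) (mean_distribution T P)"
        by (rule tv_dist_nonneg[OF prob_space_P prob_space_mean_distribution[OF horizon P]])
      then have "0 \<le> fbar * tv_dist (P t) (mean_distribution T P)"
        using fbar_nonneg by simp
      then show ?thesis
        using expected_OPT_le False by (simp add: Pt.prob_space)
    qed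
    finally show ?thesis .
  qed
  have int: "integrable (PiM (insert t ?I) P) (\<lambda>\<gamma>. dual_value \<gamma> t)"
    unfolding I(1) by (rule integrable_dual_value[OF t])
  have "?c = (\<integral>x. ?c \<partial>PiM ?I P)"
    by (simp add: pair.prob_space)
  also have "\<dots> \<le> (\<integral>x. \<integral>y. dual_value (x(t := y)) t \<partial>P t \<partial>PiM ?I P)"
    using inner by (intro integral_mono integrable_inner_dual_value[OF t] pair.integrable_const) auto
  also have "\<dots> = (\<integral>\<gamma>. dual_value \<gamma> t \<partial>\<Omega>)"
    using product.product_integral_insert[OF I(2,3) int] unfolding I(1) by simp
  finally show ?thesis .
qed

lemma expected_regret:
  "(\<integral>\<gamma>. (OPT T \<rho> \<gamma> - total_reward sel h \<eta> \<mu>\<^sub>1 \<rho> T \<gamma>) \<partial>\<Omega>)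
    \<le> C1 + C2 * \<eta> * real T + C3 / \<eta> + fbar * mean_deviation T P"
proof -
  let ?E = "\<integral>\<gamma>. OPT T \<rho> \<gamma> \<partial>\<Omega>" and ?R = "\<integral>\<gamma>. total_reward sel h \<eta> \<mu>\<^sub>1 \<rho> T \<gamma> \<partial>\<Omega>"
  have "?E - fbar * mean_deviation T P =
      (\<Sum>t<T. ?E / real T - fbar * tv_dist (P t) (mean_distribution T P))"
    using horizon by (simp add: mean_deviation_def sum_subtractf sum_distrib_left)
  also have "\<dots> \<le> (\<Sum>t<T. \<integral>\<gamma>. dual_value \<gamma> t \<partial>\<Omega>)"
    by (intro sum_mono expected_dual_value_ge) simp
  also have "\<dots> = (\<integral>\<gamma>. (\<Sum>t<T. dual_value \<gamma> t) \<partial>\<Omega>)"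
    by (intro Bochner_Integration.integral_sum[symmetric] integrable_dual_value) simp
  also have "\<dots> \<le> (\<integral>\<gamma>. total_reward sel h \<eta> \<mu>\<^sub>1 \<rho> T \<gamma> + (C1 + C2 * \<eta> * real T + C3 / \<eta>) \<partial>\<Omega>)"
    using dual_value_le_total_reward[OF space_Omega eta_pos]
    by (intro integral_mono Bochner_Integration.integrable_sum integrable_dual_value
        Bochner_Integration.integrable_add integrable_total_reward Omega.integrable_const) auto
  also have "\<dots> = ?R + (C1 + C2 * \<eta> * real T + C3 / \<eta>)"
    using integrable_total_reward by (simp add: Omega.prob_space)
  finally show ?thesis
    using integrable_OPT integrable_total_reward by simp
qed

end

section \<open>The supremum over all admissible distributions, including step size zero\<close>

theorem theorem3:
  fixes S :: "('d::finite, 'm::finite) request measure"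
    and \<rho> \<mu>\<^sub>1 :: "real ^ 'm"
    and h :: "real ^ 'm \<Rightarrow> real"
    and sel :: "('d, 'm) selection"
    and fbar bbar \<sigma> \<eta> \<delta> :: real
    and T :: nat
  defines "\<Omega> \<equiv> PiM {..<T} (\<lambda>_. S)"
    and "C1 \<equiv> fbar * bbar / Min (range (\<lambda>j. \<rho> $ j))"
    and "C2 \<equiv> (bbar + Max (range (\<lambda>j. \<rho> $ j)))\<^sup>2 / (2 * \<sigma>)"
    and "C3 \<equiv> Max ((\<lambda>\<mu>. bregman h \<mu> \<mu>\<^sub>1) `
                 insert 0 (range (\<lambda>j. (fbar / \<rho> $ j) *\<^sub>R axis j 1)))"
    and "C4 \<equiv> fbar"
  assumes horizon: "T \<ge> 1"
    and resources: "\<forall>j. 0 < \<rho> $ j"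
    and requests: "\<forall>\<gamma> \<in> space S. valid_request \<gamma>"
    and assumption1: "assumption1 (space S) fbar bbar"
    and assumption2: "assumption2 h \<sigma>"
    and step_size: "\<eta> \<ge> 0"
    and initial_dual: "0 \<le> \<mu>\<^sub>1" "h differentiable (at \<mu>\<^sub>1 within orthant)"
    and selection: "valid_selection (space S) sel"
    and measurable_OPT: "OPT T \<rho> \<in> borel_measurable \<Omega>"
    and measurable_total_reward: "total_reward sel h \<eta> \<mu>\<^sub>1 \<rho> T \<in> borel_measurable \<Omega>"
    and measurable_reward:
      "\<forall>t<T. (\<lambda>\<gamma>. reward (\<gamma> t) (tentative sel h \<eta> \<mu>\<^sub>1 \<rho> \<gamma> t)) \<in> borel_measurable \<Omega>"
    and measurable_consumption:
      "\<forall>t<T. (\<lambda>\<gamma>. consumption (\<gamma> t) (tentative sel h \<eta> \<mu>\<^sub>1 \<rho> \<gamma> t)) \<in> borel_measurable \<Omega>"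
    and delta: "\<delta> > 0"
  shows "(SUP P \<in> C_ID S T \<delta>.
            ereal (\<integral>\<gamma>. (OPT T \<rho> \<gamma> - total_reward sel h \<eta> \<mu>\<^sub>1 \<rho> T \<gamma>) \<partial>(PiM {..<T} P)))
         \<le> ereal C1 + ereal (C2 * \<eta> * real T) + ereal C3 / ereal \<eta> + ereal (C4 * \<delta>)"
proof (rule SUP_least)
  fix P assume "P \<in> C_ID S T \<delta>"
  then have P: "\<And>t. t < T \<Longrightarrow> P t \<in> space (prob_algebra S)" and dev: "mean_deviation T P \<le> \<delta>"
    by (auto simp: C_ID_def PiE_iff)
  interpret mirror_map h \<sigma>
    by unfold_locales (rule assumption2)
  interpret A: allocation h \<sigma> S sel \<eta> fbar bbar \<mu>\<^sub>1 \<rho> T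
    using resources requests assumption1 step_size initial_dual selection
    by unfold_locales (auto simp: smooth_def)
  have C: "C1 = A.C1" "C2 = A.C2" "C3 = A.C3"
    by (simp_all add: C1_def C2_def C3_def A.C1_def A.C2_def A.C3_def)
  let ?E = "\<integral>\<gamma>. (OPT T \<rho> \<gamma> - total_reward sel h \<eta> \<mu>\<^sub>1 \<rho> T \<gamma>) \<partial>(PiM {..<T} P)"
  show "ereal ?E \<le> ereal C1 + ereal (C2 * \<eta> * real T) + ereal C3 / ereal \<eta> + ereal (C4 * \<delta>)"
  proof (cases "\<eta> = 0")
    case True
    show ?thesis
    proof (cases "fbar = 0")
      case fbar: True
      have "OPT T \<rho> \<gamma> - total_reward sel h \<eta> \<mu>\<^sub>1 \<rho> T \<gamma> = 0" if "\<gamma> \<in> space (PiM {..<T} P)" for \<gamma>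
      proof -
        have "\<gamma> t \<in> space S" if "t < T" for t
          using \<open>\<gamma> \<in> space (PiM {..<T} P)\<close> P[OF that] that sets_eq_imp_space_eq[of "P t" S]
          by (auto simp: space_PiM space_prob_algebra)
        then have "\<gamma> \<in> A.paths"
          by (simp add: A.paths_def)
        then show ?thesis
          using A.OPT_le[of \<gamma>] A.OPT_nonneg[of \<gamma>] A.total_reward_le[of \<gamma>]
            A.total_reward_nonneg[of \<gamma>] fbar
          by simp
      qed
      then have "?E = 0"
        by (intro integral_eq_zero_AE AE_I2)
      \<comment> \<open>Divided by zero in \<open>ereal\<close>, a nonnegative \<open>C3\<close>
        gives 0 or infinity, so the right-hand side is not negative.\<close>
      moreover have "0 \<le> C3"
        using A.C3_nonneg by (simp add: C)
      ultimately show ?thesis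
        using True fbar by (auto simp: C1_def C4_def)
    next
      case False
      then have "0 < C3"
        using A.C3_pos A.fbar_nonneg by (simp add: C)
      then show ?thesis
        using True by (simp add: divide_ereal_def)
    qed
  next
    case False
    \<comment> \<open>Members of \<open>C_ID\<close> are undefined beyond the horizon. Padding with
      \<open>P 0\<close> makes every component a probability measure on \<open>S\<close> and changes
      neither the product nor the mean deviation.\<close>
    define Q where "Q t = (if t < T then P t else P 0)" for t
    interpret B: stochastic_allocation h \<sigma> S sel \<eta> fbar bbar \<mu>\<^sub>1 \<rho> T Q
      using horizon step_size False P measurable_OPT measurable_total_reward measurable_reward
        measurable_consumption
      by unfold_locales (auto simp: Q_def \<Omega>_def)
    have PiM: "PiM {..<T} Q = PiM {..<T} P"
      by (intro PiM_cong) (auto simp: Q_def)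
    have "mean_distribution T Q = mean_distribution T P"
      unfolding mean_distribution_def
      by (intro bind_cong) (auto simp: Q_def space_uniform_count_measure)
    then have "mean_deviation T Q = mean_deviation T P"
      by (simp add: mean_deviation_def Q_def)
    then have "fbar * mean_deviation T Q \<le> C4 * \<delta>"
      using dev A.fbar_nonneg by (simp add: C4_def mult_left_mono)
    then have "?E \<le> C1 + C2 * \<eta> * real T + C3 / \<eta> + C4 * \<delta>"
      using B.expected_regret unfolding PiM C by simp
    then show ?thesis
      using False by simp
  qed
qed

end
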